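(* Let $r$ be a positive integer and $n$ an integer or half-integer such that $n\ge r-1$. Then $$\sum_{k_1,\dots,k_r=-n}^n\ \prod_{1\le i<j\le r}\big|k_i^2-k_j^2\big|\ \prod_{i=1}^r\binom{2n}{n+k_i} =2^{2rn-r(r-1)}\,\frac{\Gamma(1+\frac r2)}{\Gamma(\frac32)}\cdot\frac{\Gamma(\lfloor n\rfloor-\frac r2+\frac32)}{\Gamma(\lfloor n\rfloor+1)}\prod_{i=1}^{r-1}\frac{\Gamma(i+1)}{\Gamma(\frac32)}\cdot\frac{\Gamma(2n+1)\,\Gamma(\lfloor n\rfloor-i+\frac32)}{\Gamma(2n-i+1)\,\Gamma(\lfloor n\rfloor-i+1)}.$$
   Context: Each $k_i$ runs over $\{-n,-n+1,\dots,n\}$, i.e. over integers if $n$ is an integer and over half-integers (elements of $\frac12+\mathbb{Z}$) if $n$ is a half-integer. *)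

theory Defs
  imports "HOL-Analysis.Analysis"
begin

definition half_integers :: "real set" where
  "half_integers = {x. x - 1 / 2 \<in> \<int>}"

text \<open>The summation range \<open>{-n, -n + 1, \<dots>, n}\<close>: integers if \<open>n\<close> is an
  integer, half-integers if \<open>n\<close> is a half-integer.\<close>

definition unit_steps :: "real \<Rightarrow> real set" where
  "unit_steps n = {k. - n \<le> k \<and> k \<le> n \<and> k + n \<in> \<int>}"

text \<open>The binomial coefficient of two real arguments \<open>a\<close> and \<open>b\<close> that are known to be
  nonnegative integers; it is applied to \<open>2 * n\<close> and \<open>n + k\<close>
  for \<open>k \<in> unit_steps n\<close>, where taking the floor changes nothing.\<close>

definition binom :: "real \<Rightarrow> real \<Rightarrow> real" where
  "binom a b = real (nat \<lfloor>a\<rfloor> choose nat \<lfloor>b\<rfloor>)"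

end

theory Submission
  imports Defs "Jordan_Normal_Form.Determinant"
begin

text \<open>
  Write \<open>p\<^sub>M\<close> for the symmetric binomial distribution \<open>k \<mapsto> binomial (2 * M) (M + k) / 4 ^ M\<close>.
  The weight \<open>binomial (2 * n) (n + k)\<close> times \<open>\<Prod>l<j. ((n - l)\<^sup>2 - k\<^sup>2)\<close> is a multiple of
  \<open>p\<^sub>n\<^sub>-\<^sub>j k\<close>. Expanding the product of the differences of squares as a determinant in these polynomials, and
  keeping the sign that the absolute value removes, turns the left-hand side into an explicit
  constant times the absolute value of
  \<open>F r n = \<Sum>\<^sub>x (\<Prod>\<^sub>i\<^sub><\<^sub>j sgn (\<bar>x i\<bar> - \<bar>x j\<bar>)) * (\<Prod>\<^sub>i p\<^sub>n\<^sub>-\<^sub>i (x i))\<close>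
  (\<open>weighted_sum_eq_pbin_pf\<close>). This is a Pfaffian in the pairing
  \<open>\<langle>p, q\<rangle> = \<Sum>\<^sub>x\<^sub>,\<^sub>y sgn (\<bar>x\<bar> - \<bar>y\<bar>) * p x * q y\<close>, and it is evaluated by a
  recurrence from \<open>F (r - 2) (n - 2)\<close> to \<open>F r n\<close>.

  Since an antisymmetric matrix of odd size is singular, there is a nonzero combination
  \<open>z = \<Sum>\<^sub>i z\<^sub>i p\<^sub>n\<^sub>-\<^sub>i\<close> over \<open>1 \<le> i < r\<close> that pairs to one and the same constant with all \<open>p\<^sub>n\<^sub>-\<^sub>i\<close> in this
  range; the constant is \<open>0\<close> for even \<open>r\<close>, and for odd \<open>r\<close> the coefficients sum to \<open>0\<close>. Expanding the
  Pfaffian along \<open>z\<close> leaves a single minor,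
  \<open>\<bar>z\<^sub>1\<bar> * \<bar>F r n\<bar> = \<bar>\<langle>z, p\<^sub>n - p\<^sub>n\<^sub>-\<^sub>1\<rangle>\<bar> * \<bar>F (r - 2) (n - 2)\<bar>\<close>
  (\<open>sgn_sum_two_step\<close>).

  It remains to find the quotient of the two factors in front. The difference \<open>p\<^sub>N - p\<^sub>N\<^sub>-\<^sub>1\<close> has a
  closed antiderivative, and so \<open>\<langle>p\<^sub>M, p\<^sub>N - p\<^sub>N\<^sub>-\<^sub>1\<rangle>\<close> is, up to factors depending on \<open>M\<close> or on \<open>N\<close> alone,
  \<open>1 / (M + N)\<close> for half-integers and \<open>2 * M / (M + N) + 1 / (2 * N - 1)\<close> for integers
  (\<open>sgn_pair_pbin_half_integer\<close>, \<open>sgn_pair_pbin_integer\<close>). Therefore \<open>\<langle>z, p\<^sub>N - p\<^sub>N\<^sub>-\<^sub>1\<rangle>\<close> is essentially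
  a rational function of \<open>N\<close> with known poles that vanishes at \<open>N = n - 1, \<dots>, n - r + 2\<close>. This
  determines it up to a scalar, and hence the quotient of its value at \<open>N = n\<close> by its residue \<open>z\<^sub>1\<close>
  (\<open>cauchy_kernel_ratio\<close>, \<open>cauchy_kernel_ratio_shifted\<close>). The product of Gamma values
  satisfies the same recurrence (\<open>pf_closed_rec\<close>).
\<close>

section \<open>Sign products\<close>

text \<open>The sign that the arrangement of \<open>insert a A\<close> in increasing order picks up when \<open>a\<close> is moved
  to the front.\<close>

definition swap_sign :: "nat set \<Rightarrow> nat \<Rightarrow> real" where
  "swap_sign A a = (\<Prod>p\<in>A. if p < a then - 1 else 1)"

text \<open>The sign of the Vandermonde product \<open>\<Prod>\<^sub>i\<^sub><\<^sub>j (x i - x j)\<close> over \<open>A\<close>. Indexing by subsets of the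
  naturals, and not by \<open>{..<r}\<close>, makes the minors that arise on deleting indices instances of the
  same function.\<close>

definition sgn_vand :: "nat set \<Rightarrow> (nat \<Rightarrow> real) \<Rightarrow> real" where
  "sgn_vand A x = (\<Prod>j\<in>A. \<Prod>i\<in>A. if i < j then sgn (x i - x j) else 1)"

lemma sgn_vand_empty [simp]: "sgn_vand {} x = 1"
  by (simp add: sgn_vand_def)

lemma sgn_vand_cong: "(\<And>i. i \<in> A \<Longrightarrow> x i = y i) \<Longrightarrow> sgn_vand A x = sgn_vand A y"
  unfolding sgn_vand_def by (intro prod.cong) auto

lemma sgn_vand_insert:
  assumes "finite A" "a \<notin> A"
  shows "sgn_vand (insert a A) x = swap_sign A a * (\<Prod>p\<in>A. sgn (x a - x p)) * sgn_vand A x"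
proof -
  define s where "s i j = (if i < j then sgn (x i - x j) else 1)" for i j :: nat
  have "sgn_vand (insert a A) x = (\<Prod>j\<in>insert a A. \<Prod>i\<in>insert a A. s i j)"
    by (simp add: sgn_vand_def s_def)
  also have "\<dots> = (\<Prod>p\<in>A. s p a * s a p) * (\<Prod>j\<in>A. \<Prod>i\<in>A. s i j)"
    using assms by (simp add: prod.distrib s_def)
  also have "(\<Prod>p\<in>A. s p a * s a p) = (\<Prod>p\<in>A. (if p < a then - 1 else 1) * sgn (x a - x p))"
  proof (intro prod.cong refl)
    fix p assume "p \<in> A"
    then have "p \<noteq> a" using assms by auto
    moreover have "sgn (x p - x a) = - sgn (x a - x p)"
      by (metis minus_diff_eq sgn_minus)
    ultimately show "s p a * s a p = (if p < a then - 1 else 1) * sgn (x a - x p)"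
      by (auto simp: s_def)
  qed
  finally show ?thesis
    by (simp add: swap_sign_def sgn_vand_def s_def prod.distrib)
qed

lemma swap_sign_insert:
  "finite B \<Longrightarrow> j \<notin> B \<Longrightarrow> swap_sign (insert j B) i = (if j < i then - 1 else 1) * swap_sign B i"
  by (simp add: swap_sign_def)

lemma swap_sign_square [simp]: "swap_sign A a * swap_sign A a = 1"
  unfolding swap_sign_def prod.distrib[symmetric] by (rule prod.neutral) auto

lemma abs_swap_sign [simp]: "\<bar>swap_sign A a\<bar> = 1"
  using swap_sign_square[of A a] by (metis abs_mult_self_eq abs_1 abs_mult power2_eq_1_iff power2_eq_square abs_minus_cancel)

lemma sgn_vand_ties:
  assumes "finite A" "i \<in> A" "j \<in> A" "i \<noteq> j" "x i = x j"
  shows "sgn_vand A x = 0"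
proof -
  have "sgn_vand (insert i (A - {i})) x = 0"
    using assms by (subst sgn_vand_insert) (auto intro!: prod_zero bexI[of _ j])
  then show ?thesis using assms by (simp add: insert_absorb)
qed

text \<open>By induction, adding a new largest point \<open>m\<close>: it flips the sign of every old term of the sum and adds the
  term \<open>sgn (y - m)\<close>.\<close>

lemma sgn_prod_expand:
  fixes y :: real
  assumes "finite B"
  shows "(\<Prod>b\<in>B. sgn (y - b)) =
    (\<Sum>b\<in>B. sgn (y - b) * (\<Prod>c\<in>B - {b}. sgn (b - c))) + (if even (card B) then 1 else 0)"
  using assms
proof (induction rule: finite_linorder_max_induct)
  case empty
  then show ?case by simp
next
  case (insert m B)
  let ?R = "\<lambda>B. \<Sum>b\<in>B. sgn (y - b) * (\<Prod>c\<in>B - {b}. sgn (b - c))"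
  have m: "m \<notin> B" using insert by auto
  have "?R (insert m B) = sgn (y - m) * (\<Prod>c\<in>insert m B - {m}. sgn (m - c))
      + (\<Sum>b\<in>B. sgn (y - b) * (\<Prod>c\<in>insert m B - {b}. sgn (b - c)))"
    using insert m by simp
  also have "(\<Prod>c\<in>insert m B - {m}. sgn (m - c)) = 1"
    using insert m by (intro prod.neutral) auto
  also have "(\<Sum>b\<in>B. sgn (y - b) * (\<Prod>c\<in>insert m B - {b}. sgn (b - c))) = - ?R B"
    unfolding sum_negf[symmetric]
  proof (intro sum.cong refl)
    fix b assume b: "b \<in> B"
    have "insert m B - {b} = insert m (B - {b})" using b m by auto
    then have "(\<Prod>c\<in>insert m B - {b}. sgn (b - c)) = sgn (b - m) * (\<Prod>c\<in>B - {b}. sgn (b - c))"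
      using insert m by simp
    moreover have "sgn (b - m) = - 1" using insert b by auto
    ultimately show "sgn (y - b) * (\<Prod>c\<in>insert m B - {b}. sgn (b - c)) = - (sgn (y - b) * (\<Prod>c\<in>B - {b}. sgn (b - c)))"
      by simp
  qed
  finally have R: "?R (insert m B) = sgn (y - m) - ?R B" by simp
  have big: "(\<Prod>b\<in>B. sgn (y - b)) = 1" if "y \<ge> m"
    using insert that by (intro prod.neutral) force
  have c: "card (insert m B) = Suc (card B)" using insert m by simp
  have P: "(\<Prod>b\<in>insert m B. sgn (y - b)) = sgn (y - m) * (\<Prod>b\<in>B. sgn (y - b))"
    using insert m by simp
  consider "y < m" | "y = m" | "y > m" by linarith
  then show ?case
    using insert.IH big unfolding P c R by cases (auto split: if_splits)
qed

text \<open>The expansion of the Pfaffian of the matrix \<open>sgn (x i - x j)\<close> along the row of an extra point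
  \<open>y\<close>; the extra term for an even number of points comes from the bordering by ones that makes an
  odd matrix even. For distinct points each minor is, up to sign, the quotient of the full sign
  product by the factors involving the deleted point.\<close>

lemma sgn_vand_expand:
  fixes y :: real
  assumes "finite A"
  shows "(\<Prod>p\<in>A. sgn (y - x p)) * sgn_vand A x =
    (\<Sum>j\<in>A. swap_sign (A - {j}) j * sgn (y - x j) * sgn_vand (A - {j}) x)
     + (if even (card A) then sgn_vand A x else 0)"
proof (cases "inj_on x A")
  case True
  have "(\<Prod>p\<in>A. sgn (y - x p)) = (\<Prod>b\<in>x ` A. sgn (y - b))"
    using True by (simp add: prod.reindex)
  also have "\<dots> = (\<Sum>j\<in>A. sgn (y - x j) * (\<Prod>c\<in>x ` A - {x j}. sgn (x j - c)))
        + (if even (card A) then 1 else 0)"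
    using True assms by (subst sgn_prod_expand) (simp_all add: sum.reindex card_image)
  also have "(\<Sum>j\<in>A. sgn (y - x j) * (\<Prod>c\<in>x ` A - {x j}. sgn (x j - c))) =
      (\<Sum>j\<in>A. sgn (y - x j) * (\<Prod>p\<in>A - {j}. sgn (x j - x p)))"
  proof (intro sum.cong refl arg_cong2[where f = "(*)"])
    fix j assume j: "j \<in> A"
    have "x ` A - {x j} = x ` (A - {j})" using True j by (auto simp: inj_on_def)
    then show "(\<Prod>c\<in>x ` A - {x j}. sgn (x j - c)) = (\<Prod>p\<in>A - {j}. sgn (x j - x p))"
      using True by (simp add: prod.reindex inj_on_diff)
  qed
  finally have e: "(\<Prod>p\<in>A. sgn (y - x p)) = \<dots> + (if even (card A) then 1 else 0)" .
  have "(\<Sum>j\<in>A. sgn (y - x j) * (\<Prod>p\<in>A - {j}. sgn (x j - x p))) * sgn_vand A x =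
     (\<Sum>j\<in>A. swap_sign (A - {j}) j * sgn (y - x j) * sgn_vand (A - {j}) x)"
    unfolding sum_distrib_right
  proof (intro sum.cong refl)
    fix j assume j: "j \<in> A"
    let ?P = "\<Prod>p\<in>A - {j}. sgn (x j - x p)"
    have "sgn_vand A x = swap_sign (A - {j}) j * ?P * sgn_vand (A - {j}) x"
      using sgn_vand_insert[of "A - {j}" j x] assms j by (simp add: insert_absorb)
    moreover have "?P * ?P = 1"
      unfolding prod.distrib[symmetric] using True j
      by (intro prod.neutral) (auto simp: inj_on_def sgn_if)
    moreover have "sgn (y - x j) * ?P * (swap_sign (A - {j}) j * ?P * sgn_vand (A - {j}) x)
       = swap_sign (A - {j}) j * sgn (y - x j) * sgn_vand (A - {j}) x * (?P * ?P)"
      by (simp only: mult_ac)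
    ultimately show "sgn (y - x j) * ?P * sgn_vand A x =
        swap_sign (A - {j}) j * sgn (y - x j) * sgn_vand (A - {j}) x"
      by simp
  qed
  then show ?thesis unfolding e by (simp add: algebra_simps)
next
  case False
  then obtain i j where ij: "i \<in> A" "j \<in> A" "i \<noteq> j" "x i = x j"
    by (auto simp: inj_on_def)
  define B where "B = A - {i, j}"
  have B: "finite B" "i \<notin> B" "j \<notin> B" "A = insert i (insert j B)" "A - {i} = insert j B" "A - {j} = insert i B"
    using ij assms by (auto simp: B_def)
  \<comment> \<open>If two points coincide, only the minors deleting one of them survive, and they cancel.\<close>
  let ?t = "\<lambda>l. swap_sign (A - {l}) l * sgn (y - x l) * sgn_vand (A - {l}) x"
  have "(\<Sum>l\<in>A. ?t l) = ?t i + ?t j + (\<Sum>l\<in>B. ?t l)"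
    using B ij by simp
  also have "(\<Sum>l\<in>B. ?t l) = 0"
  proof (intro sum.neutral ballI)
    fix l assume l: "l \<in> B"
    have "sgn_vand (A - {l}) x = 0"
      using ij l assms B by (intro sgn_vand_ties[of _ i j]) auto
    then show "?t l = 0" by simp
  qed
  also have "?t i + ?t j = 0"
    unfolding B(5,6) using B ij
    by (auto simp: sgn_vand_insert swap_sign_insert algebra_simps)
  finally show ?thesis using sgn_vand_ties[OF assms ij] by simp
qed

lemma sgn_vand_transpose:
  assumes "finite A" "i \<in> A" "j \<in> A" "i \<noteq> j"
  shows "sgn_vand A (x \<circ> Transposition.transpose i j) = - sgn_vand A x"
proof -
  define B where "B = A - {i, j}"
  have B: "finite B" "i \<notin> B" "j \<notin> B" "A = insert i (insert j B)"
    using assms by (auto simp: B_def)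
  let ?y = "x \<circ> Transposition.transpose i j"
  have y: "?y i = x j" "?y j = x i" "\<And>p. p \<in> B \<Longrightarrow> ?y p = x p"
    using B by (auto simp: Transposition.transpose_def)
  have "sgn_vand B ?y = sgn_vand B x" using y by (intro sgn_vand_cong)
  moreover have "(\<Prod>p\<in>B. sgn (x i - ?y p)) = (\<Prod>p\<in>B. sgn (x i - x p))"
     "(\<Prod>p\<in>B. sgn (x j - ?y p)) = (\<Prod>p\<in>B. sgn (x j - x p))"
    using y by (simp_all cong: prod.cong)
  moreover have "sgn (x j - x i) = - sgn (x i - x j)"
    by (metis minus_diff_eq sgn_minus)
  ultimately show ?thesis
    unfolding B(4) using B assms(4) y(1,2) by (simp add: sgn_vand_insert del: o_apply)
qed

lemma bij_betw_PiE_reindex: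
  assumes inj: "inj_on f A"
  shows "bij_betw (\<lambda>x. restrict (\<lambda>i. x (f i)) A) (f ` A \<rightarrow>\<^sub>E X) (A \<rightarrow>\<^sub>E X)"
proof (rule bij_betwI[where g = "\<lambda>y. restrict (\<lambda>i. y (inv_into A f i)) (f ` A)"])
  show "(\<lambda>x. restrict (\<lambda>i. x (f i)) A) \<in> (f ` A \<rightarrow>\<^sub>E X) \<rightarrow> (A \<rightarrow>\<^sub>E X)" by auto
  show "(\<lambda>y. restrict (\<lambda>i. y (inv_into A f i)) (f ` A)) \<in> (A \<rightarrow>\<^sub>E X) \<rightarrow> (f ` A \<rightarrow>\<^sub>E X)"
    using inj by auto
next
  fix x assume "x \<in> f ` A \<rightarrow>\<^sub>E X"
  then show "restrict (\<lambda>i. restrict (\<lambda>i. x (f i)) A (inv_into A f i)) (f ` A) = x"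
    using inj by (intro ext) (auto simp: restrict_def PiE_iff extensional_def)
next
  fix y assume "y \<in> A \<rightarrow>\<^sub>E X"
  then show "restrict (\<lambda>i. restrict (\<lambda>i. y (inv_into A f i)) (f ` A) (f i)) A = y"
    using inj by (intro ext) (auto simp: restrict_def PiE_iff extensional_def)
qed

section \<open>Signed sums over tuples\<close>

text \<open>The antisymmetric pairing that compares two independent points by the key \<open>\<kappa>\<close>.\<close>

definition sgn_pair :: "'a set \<Rightarrow> ('a \<Rightarrow> real) \<Rightarrow> ('a \<Rightarrow> real) \<Rightarrow> ('a \<Rightarrow> real) \<Rightarrow> real" where
  "sgn_pair X \<kappa> p q = (\<Sum>x\<in>X. \<Sum>y\<in>X. sgn (\<kappa> x - \<kappa> y) * p x * q y)"

text \<open>By de Bruijn's formula this is a Pfaffian: of the matrix \<open>sgn_pair X \<kappa> (g i) (g j)\<close> if \<open>A\<close> has an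
  even number of elements, and of that matrix bordered by the totals of the \<open>g i\<close> otherwise. Taking
  the multiple sum as the definition makes multilinearity and antisymmetry immediate; the expansion
  along a row is the lemma that has to be proved.\<close>

definition sgn_sum :: "'a set \<Rightarrow> ('a \<Rightarrow> real) \<Rightarrow> nat set \<Rightarrow> (nat \<Rightarrow> 'a \<Rightarrow> real) \<Rightarrow> real" where
  "sgn_sum X \<kappa> A g = (\<Sum>x\<in>A \<rightarrow>\<^sub>E X. sgn_vand A (\<lambda>i. \<kappa> (x i)) * (\<Prod>i\<in>A. g i (x i)))"

lemma sum_PiE_insert:
  assumes "a \<notin> A"
  shows "(\<Sum>x\<in>insert a A \<rightarrow>\<^sub>E X. h x) = (\<Sum>u\<in>X. \<Sum>x\<in>A \<rightarrow>\<^sub>E X. h (x(a := u)))"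
proof -
  have inj: "inj_on (\<lambda>(u, x). x(a := u)) (X \<times> (A \<rightarrow>\<^sub>E X))"
    using inj_combinator[OF assms, of "\<lambda>_. X"] by simp
  show ?thesis
    unfolding PiE_insert_eq sum.reindex[OF inj] by (simp add: sum.cartesian_product split_def)
qed

lemma sgn_sum_cong: "(\<And>i. i \<in> A \<Longrightarrow> g i = h i) \<Longrightarrow> sgn_sum X \<kappa> A g = sgn_sum X \<kappa> A h"
  unfolding sgn_sum_def by (intro sum.cong refl arg_cong2[where f = "(*)"] prod.cong) auto

lemma sgn_sum_empty [simp]: "sgn_sum X \<kappa> {} g = 1"
  by (simp add: sgn_sum_def)

lemma sgn_sum_singleton [simp]: "sgn_sum X \<kappa> {a} g = (\<Sum>x\<in>X. g a x)"
  unfolding sgn_sum_def by (subst sum_PiE_insert) (simp_all add: sgn_vand_def)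

lemma sgn_sum_integrate_out:
  assumes "finite A" "j \<in> A"
  shows "(\<Sum>x\<in>A \<rightarrow>\<^sub>E X. f (x j) * sgn_vand (A - {j}) (\<lambda>i. \<kappa> (x i)) * (\<Prod>i\<in>A. g i (x i)))
     = (\<Sum>v\<in>X. f v * g j v) * sgn_sum X \<kappa> (A - {j}) g"
proof -
  define B where "B = A - {j}"
  have B: "finite B" "j \<notin> B" "A = insert j B" "A - {j} = B" using assms by (auto simp: B_def)
  have "(\<Prod>i\<in>B. g i ((x(j := v)) i)) = (\<Prod>i\<in>B. g i (x i))"
       "sgn_vand B (\<lambda>i. \<kappa> ((x(j := v)) i)) = sgn_vand B (\<lambda>i. \<kappa> (x i))" for x v
    using B by (auto intro!: prod.cong sgn_vand_cong)
  then show ?thesis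
    unfolding B(4) unfolding B(3) using B
    by (simp add: sum_PiE_insert sgn_sum_def sum_product mult_ac)
qed

text \<open>The Pfaffian expansion along the row \<open>a\<close>, obtained by summing the pointwise expansion of the signs.\<close>

lemma sgn_sum_expand:
  assumes "finite A" "a \<notin> A"
  shows "sgn_sum X \<kappa> (insert a A) g = swap_sign A a *
    ((\<Sum>j\<in>A. swap_sign (A - {j}) j * sgn_pair X \<kappa> (g a) (g j) * sgn_sum X \<kappa> (A - {j}) g)
     + (if even (card A) then (\<Sum>x\<in>X. g a x) * sgn_sum X \<kappa> A g else 0))"
proof -
  have upd: "(\<Prod>i\<in>A. g i ((x(a := u)) i)) = (\<Prod>i\<in>A. g i (x i))" for x u
    using assms by (auto intro!: prod.cong)
  have vand: "sgn_vand (insert a A) (\<lambda>i. \<kappa> ((x(a := u)) i)) = swap_sign A a *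
     ((\<Sum>j\<in>A. swap_sign (A - {j}) j * sgn (\<kappa> u - \<kappa> (x j)) * sgn_vand (A - {j}) (\<lambda>i. \<kappa> (x i)))
     + (if even (card A) then sgn_vand A (\<lambda>i. \<kappa> (x i)) else 0))" for x u
  proof -
    have "sgn_vand (insert a A) (\<lambda>i. \<kappa> ((x(a := u)) i)) =
       swap_sign A a * (\<Prod>p\<in>A. sgn (\<kappa> ((x(a := u)) a) - \<kappa> ((x(a := u)) p)))
        * sgn_vand A (\<lambda>i. \<kappa> ((x(a := u)) i))"
      using assms by (rule sgn_vand_insert)
    also have "(\<Prod>p\<in>A. sgn (\<kappa> ((x(a := u)) a) - \<kappa> ((x(a := u)) p))) = (\<Prod>p\<in>A. sgn (\<kappa> u - \<kappa> (x p)))"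
      using assms by (auto intro!: prod.cong)
    also have "sgn_vand A (\<lambda>i. \<kappa> ((x(a := u)) i)) = sgn_vand A (\<lambda>i. \<kappa> (x i))"
      using assms by (auto intro!: sgn_vand_cong)
    finally show ?thesis
      using sgn_vand_expand[OF assms(1), of "\<kappa> u" "\<lambda>i. \<kappa> (x i)"] by (simp add: mult.assoc)
  qed
  let ?G = "\<lambda>x. \<Prod>i\<in>A. g i (x i)"
  have "sgn_sum X \<kappa> (insert a A) g = (\<Sum>u\<in>X. \<Sum>x\<in>A \<rightarrow>\<^sub>E X.
      swap_sign A a * ((\<Sum>j\<in>A. swap_sign (A - {j}) j * g a u *
         (sgn (\<kappa> u - \<kappa> (x j)) * sgn_vand (A - {j}) (\<lambda>i. \<kappa> (x i)) * ?G x))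
     + (if even (card A) then g a u * (sgn_vand A (\<lambda>i. \<kappa> (x i)) * ?G x) else 0)))"
    using assms unfolding sgn_sum_def
    by (auto simp: sum_PiE_insert vand upd sum_distrib_left sum_distrib_right
        algebra_simps intro!: sum.cong simp del: fun_upd_apply) (simp_all add: algebra_simps)
  also have "\<dots> = swap_sign A a * ((\<Sum>u\<in>X. \<Sum>j\<in>A. swap_sign (A - {j}) j * g a u *
         (\<Sum>x\<in>A \<rightarrow>\<^sub>E X. sgn (\<kappa> u - \<kappa> (x j)) * sgn_vand (A - {j}) (\<lambda>i. \<kappa> (x i)) * ?G x))
     + (\<Sum>u\<in>X. if even (card A) then g a u * sgn_sum X \<kappa> A g else 0))"
    unfolding sgn_sum_def sum_distrib_left[symmetric] sum.distrib
    by (intro arg_cong2[where f = "(*)"] arg_cong2[where f = "(+)"] refl sum.cong)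
       (subst sum.swap, simp_all add: sum_distrib_left)
  also have "(\<Sum>u\<in>X. \<Sum>j\<in>A. swap_sign (A - {j}) j * g a u *
         (\<Sum>x\<in>A \<rightarrow>\<^sub>E X. sgn (\<kappa> u - \<kappa> (x j)) * sgn_vand (A - {j}) (\<lambda>i. \<kappa> (x i)) * ?G x))
     = (\<Sum>u\<in>X. \<Sum>j\<in>A. swap_sign (A - {j}) j * g a u *
         ((\<Sum>v\<in>X. sgn (\<kappa> u - \<kappa> v) * g j v) * sgn_sum X \<kappa> (A - {j}) g))"
    using assms by (intro sum.cong refl) (simp add: sgn_sum_integrate_out[where f = "\<lambda>v. sgn (\<kappa> _ - \<kappa> v)"])
  also have "\<dots> = (\<Sum>j\<in>A. swap_sign (A - {j}) j * sgn_pair X \<kappa> (g a) (g j) * sgn_sum X \<kappa> (A - {j}) g)"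
    by (subst sum.swap) (simp add: sgn_pair_def sum_distrib_left sum_distrib_right mult_ac)
  also have "(\<Sum>u\<in>X. if even (card A) then g a u * sgn_sum X \<kappa> A g else 0) =
    (if even (card A) then (\<Sum>x\<in>X. g a x) * sgn_sum X \<kappa> A g else 0)"
    by (simp add: sum_distrib_right)
  finally show ?thesis .
qed

text \<open>Pfaffians with two equal rows vanish; here the two rows are those of totals. The proof takes the
  point \<open>y\<close> of the sign expansion to be larger than all others, where every \<open>sgn (y - x j)\<close> is \<open>1\<close>.\<close>

lemma sgn_sum_alternating_minors:
  assumes "finite A" "even (card A)"
  shows "(\<Sum>j\<in>A. swap_sign (A - {j}) j * (\<Sum>x\<in>X. g j x) * sgn_sum X \<kappa> (A - {j}) g) = 0"
proof -
  have 0: "(\<Sum>j\<in>A. swap_sign (A - {j}) j * sgn_vand (A - {j}) x) = 0" for x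
  proof (cases "A = {}")
    case False
    define y where "y = Max (x ` A) + 1"
    have y: "sgn (y - x p) = 1" if "p \<in> A" for p
    proof -
      have "x p \<le> Max (x ` A)" using that assms by simp
      then show ?thesis by (simp add: y_def)
    qed
    then show ?thesis
      using sgn_vand_expand[OF assms(1), of y x] assms(2) by simp
  qed auto
  have "(\<Sum>j\<in>A. swap_sign (A - {j}) j * (\<Sum>x\<in>X. g j x) * sgn_sum X \<kappa> (A - {j}) g)
     = (\<Sum>j\<in>A. swap_sign (A - {j}) j * (\<Sum>x\<in>A \<rightarrow>\<^sub>E X. sgn_vand (A - {j}) (\<lambda>i. \<kappa> (x i)) * (\<Prod>i\<in>A. g i (x i))))"
    using assms sgn_sum_integrate_out[where f = "\<lambda>_. 1" and X = X and \<kappa> = \<kappa> and g = g and A = A]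
    by (intro sum.cong refl) simp
  also have "\<dots> = (\<Sum>x\<in>A \<rightarrow>\<^sub>E X. (\<Sum>j\<in>A. swap_sign (A - {j}) j * sgn_vand (A - {j}) (\<lambda>i. \<kappa> (x i))) * (\<Prod>i\<in>A. g i (x i)))"
    unfolding sum_distrib_left sum_distrib_right by (subst sum.swap) (simp add: mult_ac)
  finally show ?thesis by (simp add: 0)
qed

lemma sgn_sum_linear:
  assumes "finite A" "a \<in> A"
  shows "sgn_sum X \<kappa> A (g(a := (\<lambda>x. \<Sum>i\<in>I. c i * h i x))) = (\<Sum>i\<in>I. c i * sgn_sum X \<kappa> A (g(a := h i)))"
proof -
  have "(\<Prod>i\<in>A. (g(a := f)) i (x i)) = f (x a) * (\<Prod>i\<in>A - {a}. g i (x i))" for f x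
    using assms by (subst prod.remove[of _ a]) (auto intro!: prod.cong)
  then show ?thesis
    unfolding sgn_sum_def by (simp add: sum_distrib_left sum_distrib_right sum.swap[of _ I] mult_ac)
qed

lemma sgn_vand_permute:
  assumes "p permutes A" "finite A"
  shows "sgn_vand A (x \<circ> p) = of_int (sign p) * sgn_vand A x"
  using assms
proof (induction arbitrary: x rule: permutes_induct)
  case id
  then show ?case by simp
next
  case (swap a b p)
  have "permutation p" using swap assms(2) by (auto simp: permutation_permutes)
  then have "sign (Transposition.transpose a b \<circ> p) = - sign p"
    using swap by (simp add: sign_compose permutation_swap_id sign_swap_id)
  moreover have "sgn_vand A (x \<circ> (Transposition.transpose a b \<circ> p)) = of_int (sign p) * - sgn_vand A x"
    using swap.IH[of "x \<circ> Transposition.transpose a b"] swap assms(2)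
    by (simp only: comp_assoc[symmetric] sgn_vand_transpose simp_thms)
  ultimately show ?case by (simp only: of_int_minus mult_minus_left mult_minus_right)
qed

lemma bij_betw_PiE_permute:
  assumes "p permutes A"
  shows "bij_betw (\<lambda>x. x \<circ> p) (A \<rightarrow>\<^sub>E X) (A \<rightarrow>\<^sub>E X)"
proof (rule bij_betwI[where g = "\<lambda>x. x \<circ> inv_into UNIV p"])
  show "(\<lambda>x. x \<circ> p) \<in> (A \<rightarrow>\<^sub>E X) \<rightarrow> (A \<rightarrow>\<^sub>E X)"
    using assms by (auto simp: PiE_iff permutes_in_image extensional_def permutes_not_in)
  show "(\<lambda>x. x \<circ> inv_into UNIV p) \<in> (A \<rightarrow>\<^sub>E X) \<rightarrow> (A \<rightarrow>\<^sub>E X)"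
    using permutes_inv[OF assms] by (auto simp: PiE_iff permutes_in_image extensional_def permutes_not_in)
qed (use assms in \<open>auto simp: comp_assoc permutes_inv_o\<close>)

lemma sgn_sum_permute:
  assumes "p permutes A" "finite A"
  shows "sgn_sum X \<kappa> A (\<lambda>i. g (p i)) = of_int (sign p) * sgn_sum X \<kappa> A g"
proof -
  have "sgn_sum X \<kappa> A (\<lambda>i. g (p i)) =
     (\<Sum>x\<in>A \<rightarrow>\<^sub>E X. sgn_vand A ((\<lambda>i. \<kappa> (x i)) \<circ> p) * (\<Prod>i\<in>A. g (p i) (x (p i))))"
    unfolding sgn_sum_def
    by (subst sum.reindex_bij_betw[OF bij_betw_PiE_permute[OF assms(1)], symmetric]) (simp add: o_def)
  also have "\<dots> = (\<Sum>x\<in>A \<rightarrow>\<^sub>E X. of_int (sign p) * (sgn_vand A (\<lambda>i. \<kappa> (x i)) * (\<Prod>i\<in>A. g i (x i))))"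
  proof (intro sum.cong refl)
    fix x
    have "(\<Prod>i\<in>A. g (p i) (x (p i))) = (\<Prod>i\<in>A. g i (x i))"
      using prod.permute[OF assms(1), of "\<lambda>i. g i (x i)"] by (simp add: o_def)
    then show "sgn_vand A ((\<lambda>i. \<kappa> (x i)) \<circ> p) * (\<Prod>i\<in>A. g (p i) (x (p i))) =
        of_int (sign p) * (sgn_vand A (\<lambda>i. \<kappa> (x i)) * (\<Prod>i\<in>A. g i (x i)))"
      unfolding sgn_vand_permute[OF assms] by simp
  qed
  finally show ?thesis by (simp add: sgn_sum_def sum_distrib_left)
qed

lemma sgn_sum_repeated:
  assumes "finite A" "i \<in> A" "j \<in> A" "i \<noteq> j" "g i = g j"
  shows "sgn_sum X \<kappa> A g = 0"
proof -
  let ?p = "Transposition.transpose i j"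
  have "(\<lambda>l. g (?p l)) = g"
    using assms(5) by (auto simp: Transposition.transpose_def)
  moreover have "sgn_sum X \<kappa> A (\<lambda>l. g (?p l)) = - sgn_sum X \<kappa> A g"
    using sgn_sum_permute[OF permutes_swap_id[OF assms(2,3)] assms(1)] assms(4)
    by (simp add: sign_swap_id)
  ultimately show ?thesis by simp
qed

lemma sgn_sum_replace:
  assumes "finite A" "I \<subseteq> A" "a \<in> I"
  shows "sgn_sum X \<kappa> A (g(a := (\<lambda>x. \<Sum>i\<in>I. c i * g i x))) = c a * sgn_sum X \<kappa> A g"
proof -
  have "a \<in> A" "finite I" using assms finite_subset by auto
  have "sgn_sum X \<kappa> A (g(a := (\<lambda>x. \<Sum>i\<in>I. c i * g i x))) = (\<Sum>i\<in>I. c i * sgn_sum X \<kappa> A (g(a := g i)))"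
    by (rule sgn_sum_linear) fact+
  also have "\<dots> = (\<Sum>i\<in>{a}. c i * sgn_sum X \<kappa> A (g(a := g i)))"
  proof (intro sum.mono_neutral_right ballI)
    fix i assume "i \<in> I - {a}"
    then have "sgn_sum X \<kappa> A (g(a := g i)) = 0"
      using assms \<open>a \<in> A\<close> by (intro sgn_sum_repeated[of A a i]) auto
    then show "c i * sgn_sum X \<kappa> A (g(a := g i)) = 0" by simp
  qed (use assms \<open>finite I\<close> in auto)
  finally show ?thesis by simp
qed

lemma sgn_pair_antisym: "sgn_pair X \<kappa> p q = - sgn_pair X \<kappa> q p"
proof -
  have "sgn (\<kappa> y - \<kappa> x) * p y * q x = - (sgn (\<kappa> x - \<kappa> y) * q x * p y)" for x y
  proof -
    have "sgn (\<kappa> y - \<kappa> x) = - sgn (\<kappa> x - \<kappa> y)"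
      by (metis minus_diff_eq sgn_minus)
    then show ?thesis by (simp only: mult_minus_left) (simp only: mult_ac)
  qed
  then show ?thesis
    unfolding sgn_pair_def sum_negf[symmetric] by (subst sum.swap) simp
qed

section \<open>Kernels of antisymmetric matrices and reduction by two variables\<close>

text \<open>An antisymmetric matrix of odd size is singular. The induction removes two indices at a time by
  passing to a Schur complement, which is again antisymmetric.\<close>

lemma antisymmetric_odd_kernel:
  fixes S :: "'i \<Rightarrow> 'i \<Rightarrow> real"
  assumes "finite I" "odd (card I)" "\<And>i j. i \<in> I \<Longrightarrow> j \<in> I \<Longrightarrow> S i j = - S j i"
  shows "\<exists>c. (\<exists>i\<in>I. c i \<noteq> 0) \<and> (\<forall>j\<in>I. (\<Sum>i\<in>I. c i * S i j) = 0)"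
  using assms
proof (induction "card I" arbitrary: I S rule: less_induct)
  case less
  have diag: "S i i = 0" if "i \<in> I" for i using less.prems(3)[OF that that] by simp
  obtain a where a: "a \<in> I" using less.prems(2) by (cases "I = {}") auto
  show ?case
  proof (cases "\<exists>b\<in>I. S a b \<noteq> 0")
    case False
    then have "(\<Sum>i\<in>I. (if i = a then 1 else 0) * S i j) = 0" if "j \<in> I" for j
      using that a by (intro sum.neutral) auto
    then show ?thesis using a by (intro exI[of _ "\<lambda>i. if i = a then 1 else 0"]) auto
  next
    case True
    then obtain b where b: "b \<in> I" "S a b \<noteq> 0" by auto
    have ab: "a \<noteq> b" using b diag a by auto
    define J where "J = I - {a, b}"
    have J: "finite J" "a \<notin> J" "b \<notin> J" "I = insert a (insert b J)" "J \<subseteq> I"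
      using less.prems(1) a b by (auto simp: J_def)
    have card: "card I = Suc (Suc (card J))" unfolding J(4) using J(1-3) ab by simp
    \<comment> \<open>The Schur complement of the block with indices \<open>a\<close> and \<open>b\<close>.\<close>
    define T where "T i j = S i j - S i b * S a j / S a b + S i a * S b j / S a b" for i j
    have T: "T i j = - T j i" if "i \<in> J" "j \<in> J" for i j
      using less.prems(3)[of i j] less.prems(3)[of i b] less.prems(3)[of a j]
        less.prems(3)[of i a] less.prems(3)[of b j] that J a b
      by (simp add: T_def field_simps b)
    have small: "card J < card I" "odd (card J)" using card less.prems(2) by auto
    have "\<exists>c. (\<exists>i\<in>J. c i \<noteq> 0) \<and> (\<forall>j\<in>J. (\<Sum>i\<in>J. c i * T i j) = 0)"
      by (rule less.hyps[OF small(1) J(1) small(2)]) (rule T)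
    then obtain c where c: "\<exists>i\<in>J. c i \<noteq> 0" "\<forall>j\<in>J. (\<Sum>i\<in>J. c i * T i j) = 0"
      by (elim exE conjE)
    define d where "d = c(a := - (\<Sum>i\<in>J. c i * S i b) / S a b, b := (\<Sum>i\<in>J. c i * S i a) / S a b)"
    have d: "(\<Sum>i\<in>I. d i * S i j) = d a * S a j + d b * S b j + (\<Sum>i\<in>J. c i * S i j)" for j
    proof -
      have "(\<Sum>i\<in>J. d i * S i j) = (\<Sum>i\<in>J. c i * S i j)"
        using J(2,3) by (intro sum.cong) (auto simp: d_def)
      then show ?thesis unfolding J(4) using J(1-3) ab by simp
    qed
    have dab: "d a = - (\<Sum>i\<in>J. c i * S i b) / S a b" "d b = (\<Sum>i\<in>J. c i * S i a) / S a b"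
      using ab by (auto simp: d_def)
    have "(\<Sum>i\<in>I. d i * S i j) = 0" if j: "j \<in> I" for j
    proof -
      consider "j = a" | "j = b" | "j \<in> J" using j J(4) by auto
      then show ?thesis
      proof cases
        case 1
        have "S b a = - S a b" by (rule less.prems(3)) fact+
        then show ?thesis unfolding d dab 1 using b(2) diag[OF a] by simp
      next
        case 2
        show ?thesis unfolding d dab 2 using b(2) diag[OF b(1)] by simp
      next
        case 3
        have "(\<Sum>i\<in>J. c i * T i j) = (\<Sum>i\<in>J. c i * S i j) + d a * S a j + d b * S b j"
          unfolding T_def dab
          by (simp add: algebra_simps sum.distrib sum_subtractf sum_distrib_left sum_divide_distrib diff_divide_distrib)
        then show ?thesis unfolding d using c 3 by simp
      qed
    qed
    moreover have "\<exists>i\<in>I. d i \<noteq> 0" using c(1) J by (auto simp: d_def)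
    ultimately show ?thesis by blast
  qed
qed

text \<open>For even size, the same is applied to the matrix bordered by a row of ones; the kernel vector
  of the bordered matrix sums to zero over the original indices and pairs to a constant, namely its
  border entry. The two parities are stated together because they feed the same reduction below.\<close>

lemma antisymmetric_bordered_kernel:
  fixes S :: "nat \<Rightarrow> nat \<Rightarrow> real"
  assumes "finite I" "I \<noteq> {}" "\<And>i j. i \<in> I \<Longrightarrow> j \<in> I \<Longrightarrow> S i j = - S j i"
  shows "\<exists>c C. (\<exists>i\<in>I. c i \<noteq> 0) \<and> (\<forall>j\<in>I. (\<Sum>i\<in>I. c i * S i j) = C) \<and>
    (odd (card I) \<longrightarrow> C = 0) \<and> (even (card I) \<longrightarrow> (\<Sum>i\<in>I. c i) = 0)"
proof (cases "odd (card I)")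
  case True
  have "\<exists>c. (\<exists>i\<in>I. c i \<noteq> 0) \<and> (\<forall>j\<in>I. (\<Sum>i\<in>I. c i * S i j) = 0)"
    using assms(1) True assms(3) by (rule antisymmetric_odd_kernel)
  then obtain c where "\<exists>i\<in>I. c i \<noteq> 0" "\<forall>j\<in>I. (\<Sum>i\<in>I. c i * S i j) = 0"
    by (elim exE conjE)
  then show ?thesis using True by (intro exI[of _ c] exI[of _ 0]) simp
next
  case False
  \<comment> \<open>The index \<open>None\<close> labels the border.\<close>
  define S' where "S' i j = (case i of None \<Rightarrow> (case j of None \<Rightarrow> 0 | Some _ \<Rightarrow> - 1)
     | Some i' \<Rightarrow> (case j of None \<Rightarrow> 1 | Some j' \<Rightarrow> S i' j'))" for i j
  let ?I = "insert None (Some ` I)"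
  have fin: "finite (Some ` I)" "None \<notin> Some ` I" using assms by auto
  have "card ?I = Suc (card I)" using assms by (simp add: card_image)
  then have "odd (card ?I)" using False by simp
  moreover have "S' i j = - S' j i" if "i \<in> ?I" "j \<in> ?I" for i j
    using that assms(3)[of "the i" "the j"] by (cases i; cases j) (auto simp: S'_def)
  moreover have "finite ?I" using fin by simp
  ultimately have "\<exists>c. (\<exists>i\<in>?I. c i \<noteq> 0) \<and> (\<forall>j\<in>?I. (\<Sum>i\<in>?I. c i * S' i j) = 0)"
    by (intro antisymmetric_odd_kernel)
  then obtain c where c: "\<exists>i\<in>?I. c i \<noteq> 0" "\<forall>j\<in>?I. (\<Sum>i\<in>?I. c i * S' i j) = 0"
    by (elim exE conjE)
  have s: "(\<Sum>i\<in>?I. c i * S' i j) = c None * S' None j + (\<Sum>i\<in>I. c (Some i) * S' (Some i) j)" for j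
    using fin by (simp add: sum.reindex)
  show ?thesis
  proof (intro exI[of _ "\<lambda>i. c (Some i)"] exI[of _ "c None"] conjI impI)
    have *: "(\<Sum>i\<in>I. c (Some i) * S i j) = c None" if "j \<in> I" for j
      using c(2)[rule_format, of "Some j"] that unfolding s by (simp add: S'_def)
    then show "\<forall>j\<in>I. (\<Sum>i\<in>I. c (Some i) * S i j) = c None" by blast
    show "(\<Sum>i\<in>I. c (Some i)) = 0"
      using c(2)[rule_format, of None] unfolding s by (simp add: S'_def)
    show "\<exists>i\<in>I. c (Some i) \<noteq> 0"
    proof (rule ccontr)
      assume "\<not> ?thesis"
      moreover from this have "c None = 0" using * assms(2) by fastforce
      ultimately show False using c(1) by auto
    qed
  qed (use False in auto)
qed

lemma sgn_pair_sum_left: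
  "sgn_pair X \<kappa> (\<lambda>x. \<Sum>i\<in>I. c i * g i x) q = (\<Sum>i\<in>I. c i * sgn_pair X \<kappa> (g i) q)"
proof -
  have "sgn_pair X \<kappa> (\<lambda>x. \<Sum>i\<in>I. c i * g i x) q =
    (\<Sum>x\<in>X. \<Sum>y\<in>X. \<Sum>i\<in>I. c i * (sgn (\<kappa> x - \<kappa> y) * g i x * q y))"
    unfolding sgn_pair_def sum_distrib_left sum_distrib_right
    by (intro sum.cong refl) (simp only: mult_ac)
  also have "\<dots> = (\<Sum>x\<in>X. \<Sum>i\<in>I. \<Sum>y\<in>X. c i * (sgn (\<kappa> x - \<kappa> y) * g i x * q y))"
    by (intro sum.cong refl sum.swap)
  also have "\<dots> = (\<Sum>i\<in>I. \<Sum>x\<in>X. \<Sum>y\<in>X. c i * (sgn (\<kappa> x - \<kappa> y) * g i x * q y))"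
    by (rule sum.swap)
  finally show ?thesis by (simp add: sgn_pair_def sum_distrib_left)
qed

text \<open>The engine of the recurrence. Replacing \<open>g a\<close> by \<open>z\<close> multiplies the sum by \<open>c a\<close>, since all other
  terms of \<open>z\<close> repeat a function. In the expansion along \<open>z\<close> all pairings equal \<open>C\<close> except the one
  with \<open>g e\<close>, and the part proportional to \<open>C\<close> vanishes: either \<open>C = 0\<close>, or it is an alternating sum
  of minors.\<close>

lemma sgn_sum_two_step:
  assumes fin: "finite A" and ae: "a \<in> A" "e \<in> A" "a \<noteq> e"
    and total: "\<And>i. i \<in> A \<Longrightarrow> (\<Sum>x\<in>X. g i x) = 1"
    and z: "z = (\<lambda>x. \<Sum>i\<in>A - {e}. c i * g i x)"
    and C: "\<And>j. j \<in> A - {a, e} \<Longrightarrow> sgn_pair X \<kappa> z (g j) = C"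
    and even: "even (card A) \<Longrightarrow> C = 0"
    and odd: "odd (card A) \<Longrightarrow> (\<Sum>i\<in>A - {e}. c i) = 0"
  shows "\<bar>c a\<bar> * \<bar>sgn_sum X \<kappa> A g\<bar> = \<bar>sgn_pair X \<kappa> z (g e) - C\<bar> * \<bar>sgn_sum X \<kappa> (A - {a, e}) g\<bar>"
proof -
  define B where "B = A - {a}"
  have B: "finite B" "a \<notin> B" "A = insert a B" "e \<in> B" "B - {e} = A - {a, e}"
    using fin ae by (auto simp: B_def)
  have cB: "card A = Suc (card B)" unfolding B(3) using B(1,2) by simp
  let ?F = "\<lambda>j. sgn_sum X \<kappa> (B - {j}) g" and ?e = "\<lambda>j. swap_sign (B - {j}) j"
  have upd: "sgn_sum X \<kappa> (B - {j}) (g(a := z)) = ?F j" "sgn_sum X \<kappa> B (g(a := z)) = sgn_sum X \<kappa> B g" for j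
    using B by (auto intro!: sgn_sum_cong)
  have "c a * sgn_sum X \<kappa> A g = sgn_sum X \<kappa> (insert a B) (g(a := z))"
    unfolding B(3)[symmetric] z using fin ae by (intro sgn_sum_replace[symmetric]) auto
  also have "\<dots> = swap_sign B a * ((\<Sum>j\<in>B. ?e j * sgn_pair X \<kappa> z (g j) * ?F j)
     + (if even (card B) then (\<Sum>x\<in>X. z x) * sgn_sum X \<kappa> B g else 0))"
    using sgn_sum_expand[OF B(1,2), of X \<kappa> "g(a := z)"] B
    by (auto simp: upd intro!: sum.cong)
  also have "(if even (card B) then (\<Sum>x\<in>X. z x) * sgn_sum X \<kappa> B g else 0) = 0"
  proof (cases "even (card B)")
    case True
    have "(\<Sum>x\<in>X. z x) = (\<Sum>i\<in>A - {e}. c i * (\<Sum>x\<in>X. g i x))"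
      unfolding z by (subst sum.swap) (simp add: sum_distrib_left)
    also have "\<dots> = 0" using total odd True cB by simp
    finally show ?thesis by simp
  qed simp
  also have "(\<Sum>j\<in>B. ?e j * sgn_pair X \<kappa> z (g j) * ?F j) =
      ?e e * (sgn_pair X \<kappa> z (g e) - C) * ?F e + C * (\<Sum>j\<in>B. ?e j * ?F j)"
  proof -
    have "(\<Sum>j\<in>B. ?e j * sgn_pair X \<kappa> z (g j) * ?F j) =
      (\<Sum>j\<in>B. (if j = e then ?e e * (sgn_pair X \<kappa> z (g e) - C) * ?F e else 0) + C * (?e j * ?F j))"
    proof (intro sum.cong refl)
      fix j assume "j \<in> B"
      then have "j \<noteq> e \<Longrightarrow> sgn_pair X \<kappa> z (g j) = C"
        using C[of j] unfolding B(5)[symmetric] by simp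
      then show "?e j * sgn_pair X \<kappa> z (g j) * ?F j =
          (if j = e then ?e e * (sgn_pair X \<kappa> z (g e) - C) * ?F e else 0) + C * (?e j * ?F j)"
        by (cases "j = e") (simp_all add: algebra_simps)
    qed
    then show ?thesis using B(1,4) by (simp add: sum.distrib sum_distrib_left)
  qed
  also have "C * (\<Sum>j\<in>B. ?e j * ?F j) = 0"
  proof (cases "even (card B)")
    case True
    have "(\<Sum>j\<in>B. ?e j * ?F j) = (\<Sum>j\<in>B. ?e j * (\<Sum>x\<in>X. g j x) * ?F j)"
      using total unfolding B(3) by (intro sum.cong) simp_all
    then show ?thesis using sgn_sum_alternating_minors[OF B(1) True, where X = X and g = g and \<kappa> = \<kappa>] by simp
  qed (use even cB in simp)
  finally have "c a * sgn_sum X \<kappa> A g =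
    swap_sign B a * ?e e * (sgn_pair X \<kappa> z (g e) - C) * sgn_sum X \<kappa> (A - {a, e}) g"
    unfolding B(5) by simp
  then have "\<bar>c a * sgn_sum X \<kappa> A g\<bar> =
    \<bar>swap_sign B a * ?e e * (sgn_pair X \<kappa> z (g e) - C) * sgn_sum X \<kappa> (A - {a, e}) g\<bar>" by simp
  then show ?thesis by (simp add: abs_mult)
qed

section \<open>The product of differences as a determinant\<close>

text \<open>Used with \<open>d\<close> at most one: a polynomial is determined by enough zeros up to a factor of low degree.\<close>

lemma poly_factor_roots:
  fixes p :: "real poly"
  assumes "finite S" "\<And>s. s \<in> S \<Longrightarrow> poly p s = 0" "degree p \<le> card S + d"
  shows "\<exists>q. p = (\<Prod>s\<in>S. [:- s, 1:]) * q \<and> degree q \<le> d"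
  using assms
proof (induction arbitrary: p rule: finite_induct)
  case empty
  then show ?case by simp
next
  case (insert s S)
  obtain p' where p': "p = [:- s, 1:] * p'"
    using insert.prems(1)[of s] by (auto simp: poly_eq_0_iff_dvd elim: dvdE)
  have "poly p' u = 0" if "u \<in> S" for u
    using insert.prems(1)[of u] insert.hyps that by (auto simp: p')
  moreover have "degree p' \<le> card S + d"
  proof (cases "p' = 0")
    case False
    then have "degree p = 1 + degree p'" unfolding p' by (subst degree_mult_eq) auto
    then show ?thesis using insert.prems(2) insert.hyps by simp
  qed simp
  ultimately obtain q where "p' = (\<Prod>s\<in>S. [:- s, 1:]) * q" "degree q \<le> d"
    using insert.IH by blast
  then show ?case using insert.hyps p' by (intro exI[of _ q]) (simp only: prod.insert mult.assoc simp_thms)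
qed

text \<open>As a function of its last row the determinant is a polynomial of degree at most \<open>r\<close> that vanishes
  at the earlier nodes and whose leading coefficient is the determinant of the previous size.\<close>

lemma det_monic_vandermonde:
  fixes y :: "nat \<Rightarrow> real" and q :: "nat \<Rightarrow> real poly"
  assumes deg: "\<And>j. degree (q j) = j" and monic: "\<And>j. Polynomial.coeff (q j) j = 1"
  shows "Determinant.det (mat r r (\<lambda>(i, j). poly (q j) (y i))) = (\<Prod>j<r. \<Prod>i<j. y j - y i)"
proof (induction r)
  case 0
  then show ?case by (simp add: det_dim_zero)
next
  case (Suc r)
  \<comment> \<open>The last node is replaced by an indeterminate value \<open>t\<close>.\<close>
  define M where "M t = mat (Suc r) (Suc r) (\<lambda>(i, j). poly (q j) (if i = r then t else y i))" for t
  have M: "M t \<in> carrier_mat (Suc r) (Suc r)" for t by (simp add: M_def)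
  have My: "M (y r) = mat (Suc r) (Suc r) (\<lambda>(i, j). poly (q j) (y i))"
    by (rule eq_matI) (auto simp: M_def)
  define C where "C j = cofactor (M 0) r j" for j
  have cof: "cofactor (M t) r j = C j" for t j
    unfolding C_def cofactor_def
    by (intro arg_cong2[where f = "(*)"] refl arg_cong[where f = Determinant.det] eq_matI)
       (auto simp: mat_delete_def M_def)
  have Cr: "C r = Determinant.det (mat r r (\<lambda>(i, j). poly (q j) (y i)))"
  proof -
    have "mat_delete (M 0) r r = mat r r (\<lambda>(i, j). poly (q j) (y i))"
      by (rule eq_matI) (auto simp: mat_delete_def M_def)
    then show ?thesis by (simp add: C_def cofactor_def mult_2[symmetric])
  qed
  define P where "P = (\<Sum>j<Suc r. Polynomial.smult (C j) (q j))"
  have detP: "Determinant.det (M t) = poly P t" for t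
  proof -
    have "Determinant.det (M t) = (\<Sum>j<Suc r. M t $$ (r, j) * cofactor (M t) r j)"
      by (rule laplace_expansion_row[OF M]) simp
    also have "\<dots> = poly P t"
      unfolding cof P_def poly_sum by (intro sum.cong refl) (simp add: M_def)
    finally show ?thesis .
  qed
  have degP: "degree P \<le> r"
    unfolding P_def using deg by (intro degree_sum_le) (auto intro: order_trans[OF degree_smult_le])
  have coeffP: "Polynomial.coeff P r = C r"
  proof -
    have "Polynomial.coeff P r = (\<Sum>j<r. C j * Polynomial.coeff (q j) r) + C r"
      by (simp add: P_def coeff_sum monic)
    also have "(\<Sum>j<r. C j * Polynomial.coeff (q j) r) = 0"
      using deg by (intro sum.neutral) (simp add: coeff_eq_0)
    finally show ?thesis by simp
  qed
  have root: "poly P (y i) = 0" if "i < r" for i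
  proof -
    have "row (M (y i)) i = row (M (y i)) r"
      using that by (intro eq_vecI) (auto simp: M_def)
    then show ?thesis
      unfolding detP[symmetric] using that by (intro det_identical_rows[OF M, of i r]) auto
  qed
  have "poly P (y r) = C r * (\<Prod>i<r. y r - y i)"
  proof (cases "inj_on y {..<r}")
    case True
    then have "degree P \<le> card (y ` {..<r}) + 0" using degP by (simp add: card_image)
    then obtain D where D: "P = (\<Prod>s\<in>y ` {..<r}. [:- s, 1:]) * D" "degree D \<le> 0"
      using poly_factor_roots[of "y ` {..<r}" P 0] root by auto
    obtain \<alpha> where \<alpha>: "D = [:\<alpha>:]" using D(2) by (metis degree_eq_zeroE le_zero_eq)
    define R where "R = (\<Prod>s\<in>y ` {..<r}. [:- s, 1:])"
    have "lead_coeff R = 1"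
      unfolding R_def lead_coeff_prod by simp
    moreover have "degree R = r"
      using True by (simp add: R_def degree_prod_eq_sum_degree card_image)
    ultimately have "Polynomial.coeff P r = \<alpha>" unfolding D(1) R_def[symmetric] \<alpha> by simp
    then have "\<alpha> = C r" using coeffP by simp
    moreover have "poly R (y r) = (\<Prod>i<r. y r - y i)"
      using True by (simp add: R_def poly_prod prod.reindex)
    ultimately show ?thesis unfolding D(1) R_def[symmetric] \<alpha> by simp
  next
    case False
    then obtain i j where ij: "i < j" "j < r" "y i = y j"
      unfolding inj_on_def by (metis lessThan_iff linorder_neqE_nat)
    have "(\<Prod>j<r. \<Prod>i<j. y j - y i) = 0"
    proof (rule prod_zero[OF finite_lessThan], rule bexI[of _ j])
      show "(\<Prod>i<j. y j - y i) = 0" using ij by (intro prod_zero bexI[of _ i]) auto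
    qed (use ij in auto)
    then have "C r = 0" unfolding Cr Suc.IH .
    have "row (M (y r)) i = row (M (y r)) j"
      using ij by (intro eq_vecI) (auto simp: M_def)
    then have "poly P (y r) = 0"
      unfolding detP[symmetric] using ij by (intro det_identical_rows[OF M, of i j]) auto
    then show ?thesis using \<open>C r = 0\<close> by simp
  qed
  then show ?case
    unfolding My[symmetric] detP Cr Suc.IH by simp
qed

lemma prod_differences_leibniz:
  fixes y :: "nat \<Rightarrow> real" and q :: "nat \<Rightarrow> real poly"
  assumes "\<And>j. degree (q j) = j" "\<And>j. Polynomial.coeff (q j) j = 1"
  shows "(\<Prod>j<r. \<Prod>i<j. y j - y i) =
    (\<Sum>p | p permutes {..<r}. of_int (sign p) * (\<Prod>i<r. poly (q (p i)) (y i)))"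
proof -
  have "(\<Prod>j<r. \<Prod>i<j. y j - y i) = Determinant.det (mat r r (\<lambda>(i, j). poly (q j) (y i)))"
    using det_monic_vandermonde[OF assms] by simp
  also have "\<dots> = (\<Sum>p | p permutes {..<r}. of_int (sign p) * (\<Prod>i<r. poly (q (p i)) (y i)))"
    unfolding Determinant.det_def
    by (auto simp: atLeast0LessThan permutes_in_image intro!: sum.cong prod.cong)
  finally show ?thesis .
qed

section \<open>Symmetric binomial distributions on a common lattice\<close>

lemma unit_steps_eq:
  assumes "2 * n = real K"
  shows "unit_steps n = (\<lambda>j. real j - n) ` {..K}"
proof (intro Set.set_eqI iffI)
  fix k assume "k \<in> unit_steps n"
  then have k: "- n \<le> k" "k \<le> n" "k + n \<in> \<int>" by (auto simp: unit_steps_def)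
  then obtain z where z: "k + n = of_int z" by (auto elim: Ints_cases)
  then have "z \<ge> 0" using k by linarith
  moreover have "nat z \<le> K" using k z assms by linarith
  ultimately show "k \<in> (\<lambda>j. real j - n) ` {..K}"
    using z by (intro image_eqI[of _ _ "nat z"]) (auto simp: algebra_simps)
qed (use assms in \<open>auto simp: unit_steps_def\<close>)

lemma finite_unit_steps: "2 * n = real K \<Longrightarrow> finite (unit_steps n)"
  by (simp add: unit_steps_eq)

lemma sum_unit_steps:
  assumes "2 * n = real K"
  shows "(\<Sum>k\<in>unit_steps n. f k) = (\<Sum>j\<le>K. f (real j - n))"
  unfolding unit_steps_eq[OF assms] by (subst sum.reindex) (auto simp: inj_on_def)

lemma sum_by_parts_unit_steps:
  fixes f s :: "real \<Rightarrow> real"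
  assumes "2 * n = real K" "f (- n) = 0" "f (n + 1) = 0"
  shows "(\<Sum>k\<in>unit_steps n. s k * (f k - f (k + 1))) = (\<Sum>k\<in>unit_steps n. f k * (s k - s (k - 1)))"
proof -
  have abel: "(\<Sum>j\<le>m. S (Suc j) * (F j - F (Suc j))) =
     (\<Sum>j\<le>m. F j * (S (Suc j) - S j)) + F 0 * S 0 - F (Suc m) * S (Suc m)"
    for m and F S :: "nat \<Rightarrow> real"
    by (induction m) (simp_all add: algebra_simps)
  define F where "F j = f (real j - n)" for j
  define S where "S j = s (real j - n - 1)" for j
  have "real (Suc j) - n - 1 = real j - n" "real (Suc j) - n = real j - n + 1" for j by simp_all
  then have S: "S (Suc j) = s (real j - n)" and F: "F (Suc j) = f (real j - n + 1)" for j
    unfolding S_def F_def by (simp_all only:)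
  have "F 0 = 0" "F (Suc K) = 0"
    using assms unfolding F by (simp_all add: F_def flip: assms(1))
  then have "(\<Sum>j\<le>K. S (Suc j) * (F j - F (Suc j))) = (\<Sum>j\<le>K. F j * (S (Suc j) - S j))"
    using abel[of S F K] by simp
  then show ?thesis
    unfolding sum_unit_steps[OF assms(1)] S F unfolding S_def F_def .
qed

text \<open>For \<open>M + k\<close> and \<open>M - k\<close> natural numbers this is \<open>1 / ((M + k)! * (M - k)!)\<close>. The entire function
  \<open>rGamma\<close> makes it vanish at the other points of the lattice, so that the weights for all parameters
  \<open>M = n - i\<close> live on the one lattice \<open>unit_steps n\<close> and the contiguity relations need no case
  distinction at the ends of the range.\<close>

definition rbin :: "real \<Rightarrow> real \<Rightarrow> real" where
  "rbin M k = rGamma (1 + M + k) * rGamma (1 + M - k)"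

lemma rbin_minus [simp]: "rbin M (- k) = rbin M k"
  by (simp add: rbin_def)

lemma rbin_alt: "rbin M k = rGamma (M + k + 1) * rGamma (M - k + 1)"
proof -
  have "1 + M + k = M + k + 1" "1 + M - k = M - k + 1" by simp_all
  then show ?thesis unfolding rbin_def by (simp only:)
qed

lemma rbin_plus1: "(M + k + 1) * rbin M (k + 1) = (M - k) * rbin M k"
proof -
  have "(M + k + 1) * rGamma (M + k + 1 + 1) = rGamma (M + k + 1)"
       "(M - k) * rGamma (M - k + 1) = rGamma (M - k)" by (rule rGamma_plus1)+
  moreover have "rbin M (k + 1) = rGamma (M + k + 1 + 1) * rGamma (M - k)"
  proof -
    have "M + (k + 1) + 1 = M + k + 1 + 1" "M - (k + 1) + 1 = M - k" by simp_all
    then show ?thesis unfolding rbin_alt by (simp only:)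
  qed
  ultimately show ?thesis unfolding rbin_alt[of M k] by (metis mult.assoc mult.left_commute)
qed

lemma rbin_pred: "rbin (M - 1) k = (M\<^sup>2 - k\<^sup>2) * rbin M k"
proof -
  have "M - 1 + k + 1 = M + k" "M - 1 - k + 1 = M - k" by simp_all
  then have "rbin (M - 1) k = rGamma (M + k) * rGamma (M - k)"
    unfolding rbin_alt by (simp only:)
  also have "\<dots> = ((M + k) * rGamma (M + k + 1)) * ((M - k) * rGamma (M - k + 1))"
    by (simp only: rGamma_plus1)
  also have "\<dots> = ((M + k) * (M - k)) * rbin M k"
    unfolding rbin_alt by (simp only: mult_ac)
  also have "(M + k) * (M - k) = M\<^sup>2 - k\<^sup>2" by (simp add: power2_eq_square algebra_simps)
  finally show ?thesis .
qed

text \<open>At \<open>- n\<close> the function \<open>rbin n\<close> itself does not vanish, whence the extra factor in the second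
  claim; it is zero exactly for \<open>i = 0\<close>.\<close>

lemma rbin_boundary:
  "rbin (n - real i) (n + 1) = 0" "(n - real i - n) * rbin (n - real i) (- n) = 0"
proof -
  have "rGamma (- real i :: real) = 0" using rGamma_eq_zero_iff by auto
  then show "rbin (n - real i) (n + 1) = 0" by (simp add: rbin_def)
  have "- real i * rGamma (- real i + 1 :: real) = rGamma (- real i)" by (rule rGamma_plus1)
  then have "real i = 0 \<or> rGamma (1 - real i :: real) = 0" using \<open>rGamma (- real i) = 0\<close>
    by (simp add: add.commute)
  then show "(n - real i - n) * rbin (n - real i) (- n) = 0"
    by (auto simp: rbin_def)
qed

text \<open>By the duplication formula this is \<open>(2 * M)! / 4 ^ M\<close>, the factor that turns \<open>rbin M\<close> into a
  probability distribution.\<close>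

definition bmass :: "real \<Rightarrow> real" where
  "bmass M = Gamma (M + 1/2) * Gamma (M + 1) / sqrt pi"

definition pbin :: "real \<Rightarrow> real \<Rightarrow> real" where
  "pbin M k = bmass M * rbin M k"

lemma bmass_rec:
  assumes "N \<ge> 1"
  shows "bmass N = N * (N - 1/2) * bmass (N - 1)"
proof -
  have "Gamma (N - 1/2 + 1) = (N - 1/2) * Gamma (N - 1/2)" "Gamma (N + 1) = N * Gamma N"
    using assms by (intro Gamma_plus1; auto elim!: nonpos_Ints_cases)+
  moreover have "N - 1/2 + 1 = N + 1/2" "N - 1 + 1/2 = N - 1/2" "N - 1 + 1 = N" by simp_all
  ultimately show ?thesis unfolding bmass_def by (simp only: mult_ac times_divide_eq_right)
qed

lemma bmass_pos: "M \<ge> 0 \<Longrightarrow> bmass M > 0"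
  by (simp add: bmass_def Gamma_real_pos)

lemma bmass_half_nat: "bmass (real K / 2) = fact K / 2 ^ K"
proof (induction K rule: less_induct)
  case (less K)
  have half: "Gamma (3 / 2 :: real) = sqrt pi / 2"
  proof -
    have "(1/2 :: real) \<notin> \<int>\<^sub>\<le>\<^sub>0" by (auto elim!: nonpos_Ints_cases)
    then show ?thesis using Gamma_plus1[of "1/2 :: real"] Gamma_one_half_real by simp
  qed
  consider "K = 0" | "K = 1" | m where "K = Suc (Suc m)"
    by (metis One_nat_def not0_implies_Suc)
  then show ?case
  proof cases
    case 3
    then have e: "real K / 2 - 1 = real m / 2" "real K / 2 \<ge> 1" by (simp_all add: field_simps)
    have "bmass (real K / 2) = real K / 2 * (real K / 2 - 1/2) * (fact m / 2 ^ m)"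
      unfolding bmass_rec[OF e(2)] e(1) using less[of m] 3 by simp
    also have "real K / 2 * (real K / 2 - 1/2) = real K * real (Suc m) / 4"
      using 3 by (simp add: field_simps)
    finally show ?thesis using 3 by (simp add: fact_Suc del: of_nat_Suc)
  qed (simp_all add: bmass_def Gamma_one_half_real half)
qed

lemma pbin_eq_binomial:
  assumes "2 * n = real K" "j \<le> K"
  shows "Gamma (2 * n + 1) * rbin n (real j - n) = real (K choose j)"
proof -
  have "1 + n + (real j - n) = 1 + real j" "1 + n - (real j - n) = 1 + real (K - j)"
    using assms by (simp_all add: of_nat_diff)
  then have "rbin n (real j - n) = 1 / (fact j * fact (K - j))"
    unfolding rbin_def rGamma_inverse_Gamma by (simp only: Gamma_fact) (simp add: field_simps)
  moreover have "Gamma (2 * n + 1) = fact K" using assms by (simp add: Gamma_fact add.commute)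
  ultimately show ?thesis using assms by (simp add: binomial_fact)
qed

text \<open>A discrete antiderivative of \<open>pbin (N - 1) - pbin N\<close>. It is antisymmetric about \<open>1/2\<close> and vanishes
  at the end points \<open>- n\<close> and \<open>n + 1\<close> of the telescoping sums over the lattice, and this is why the pairings of such differences can be evaluated.\<close>

definition pbin_step :: "real \<Rightarrow> real \<Rightarrow> real" where
  "pbin_step N l = bmass (N - 1) * (l - 1/2) * ((N + l) * rbin N l) / 2"

lemma pbin_diff:
  assumes "N \<ge> 1"
  shows "pbin N l - pbin (N - 1) l = pbin_step N l - pbin_step N (l + 1)"
proof -
  have s: "(N + (l + 1)) * rbin N (l + 1) = (N - l) * rbin N l"
    using rbin_plus1[of N l] by (simp add: algebra_simps)
  show ?thesis
    unfolding pbin_step_def s pbin_def rbin_pred bmass_rec[OF assms]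
    by (simp add: field_simps power2_eq_square)
qed

lemma pbin_step_reflect: "pbin_step N (1 - l) = - pbin_step N l"
proof -
  have "(N + l) * rbin N l = (N + 1 - l) * rbin N (l - 1)"
    using rbin_plus1[of N "l - 1"] by (simp add: algebra_simps)
  moreover have "rbin N (1 - l) = rbin N (l - 1)" using rbin_minus[of N "l - 1"] by simp
  moreover have "(N + (1 - l)) * rbin N (l - 1) = (N + 1 - l) * rbin N (l - 1)" by (simp add: algebra_simps)
  ultimately have "(N + (1 - l)) * rbin N (1 - l) = (N + l) * rbin N l" by (simp only:)
  then show ?thesis unfolding pbin_step_def by (simp only:) (simp add: field_simps)
qed

lemma pbin_step_boundary:
  "pbin_step (n - real i) (- n) = 0" "pbin_step (n - real i) (n + 1) = 0"
  using rbin_boundary[of n i] unfolding pbin_step_def by simp_all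

lemma pbin_step_add:
  assumes "N \<ge> 1"
  shows "pbin_step N k + pbin_step N (k + 1) = k * pbin N k / N"
proof -
  have s: "(N + (k + 1)) * rbin N (k + 1) = (N - k) * rbin N k"
    using rbin_plus1[of N k] by (simp add: algebra_simps)
  show ?thesis
    unfolding pbin_step_def s pbin_def bmass_rec[OF assms] using assms by (simp add: field_simps)
qed

lemma pbin_total:
  assumes "2 * n = real K" "real i \<le> n"
  shows "(\<Sum>k\<in>unit_steps n. pbin (n - real i) k) = 1"
  using assms(2)
proof (induction i)
  case 0
  have n: "n \<ge> 0" using assms by linarith
  have "(\<Sum>k\<in>unit_steps n. Gamma (2 * n + 1) * rbin n k) = (\<Sum>j\<le>K. real (K choose j))"
    unfolding sum_unit_steps[OF assms(1)]
    by (intro sum.cong refl pbin_eq_binomial[OF assms(1)]) simp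
  also have "\<dots> = real (2 ^ K)" unfolding of_nat_sum[symmetric] by (simp only: choose_row_sum)
  also have "Gamma (2 * n + 1) = fact K" unfolding assms(1) using Gamma_fact[of K] by (simp add: add.commute)
  finally have row: "fact K * (\<Sum>k\<in>unit_steps n. rbin n k) = 2 ^ K"
    by (simp add: sum_distrib_left)
  have mass: "bmass n = fact K / 2 ^ K"
  proof -
    have "n = real K / 2" using assms(1) by simp
    then show ?thesis by (simp only: bmass_half_nat)
  qed
  have "(\<Sum>k\<in>unit_steps n. pbin (n - real 0) k) = bmass n * (\<Sum>k\<in>unit_steps n. rbin n k)"
    by (simp add: pbin_def sum_distrib_left)
  also have "\<dots> = (fact K * (\<Sum>k\<in>unit_steps n. rbin n k)) / 2 ^ K"
    unfolding mass by simp
  also have "\<dots> = 1" unfolding row by simp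
  finally show ?case .
next
  case (Suc i)
  let ?N = "n - real i"
  have N: "?N \<ge> 1" using Suc by simp
  have "(\<Sum>k\<in>unit_steps n. pbin ?N k) - (\<Sum>k\<in>unit_steps n. pbin (?N - 1) k) =
     (\<Sum>k\<in>unit_steps n. 1 * (pbin_step ?N k - pbin_step ?N (k + 1)))"
    unfolding sum_subtractf[symmetric] by (simp add: pbin_diff[OF N])
  also have "\<dots> = 0"
    by (subst sum_by_parts_unit_steps[OF assms(1)]) (simp_all add: pbin_step_boundary)
  finally show ?case using Suc by (simp add: algebra_simps)
qed

lemma unit_steps_diff_Ints:
  assumes "2 * n = real K" "x \<in> unit_steps n" "y \<in> unit_steps n"
  shows "x - y \<in> \<int>" "x + y \<in> \<int>"
proof -
  have "x + n \<in> \<int>" "y + n \<in> \<int>" using assms by (auto simp: unit_steps_def)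
  moreover have "2 * n \<in> \<int>" using assms by simp
  ultimately have "(x + n) - (y + n) \<in> \<int>" "(x + n) + (y + n) - 2 * n \<in> \<int>" by (blast intro: Ints_diff Ints_add)+
  then show "x - y \<in> \<int>" "x + y \<in> \<int>" by simp_all
qed

text \<open>As \<open>y\<close> runs through the lattice in unit steps, \<open>sgn (k - \<bar>y\<bar>)\<close> rises from \<open>- 1\<close> to \<open>1\<close> around
  \<open>- k\<close> and falls back around \<open>k\<close>, in two jumps of height one each.\<close>

lemma sgn_abs_jump:
  fixes k y :: real
  assumes "k > 0" "y - k \<in> \<int>" "y + k \<in> \<int>"
  shows "sgn (k - \<bar>y\<bar>) - sgn (k - \<bar>y - 1\<bar>) =
    of_bool (y = - k) + of_bool (y = 1 - k) - of_bool (y = k) - of_bool (y = k + 1)"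
proof -
  obtain a b where ab: "y - k = of_int a" "y + k = of_int b"
    using assms by (auto elim!: Ints_cases)
  have "real_of_int a < real_of_int b" using ab assms(1) by linarith
  then have lt: "a < b" by simp
  have s: "sgn (k - \<bar>z\<bar>) = (if b > 0 \<and> a < 0 then 1 else if b = 0 \<or> a = 0 then 0 else - 1)"
    if "z - k = of_int a" "z + k = of_int b" for z a b
  proof -
    have "z = k + of_int a" "real_of_int b = 2 * k + real_of_int a" using that by simp_all
    then show ?thesis using assms(1) by (auto simp: sgn_if abs_if split: if_splits)
  qed
  have e: "y = - k \<longleftrightarrow> b = 0" "y = 1 - k \<longleftrightarrow> b = 1" "y = k \<longleftrightarrow> a = 0" "y = k + 1 \<longleftrightarrow> a = 1"
    using ab by linarith+
  have "y - 1 - k = of_int (a - 1)" "y - 1 + k = of_int (b - 1)" using ab by simp_all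
  note s1 = s[OF this] and s0 = s[OF ab]
  show ?thesis unfolding s0 s1 e using lt by auto
qed

text \<open>Summation by parts leaves the four values of the antiderivative at the jumps, and its antisymmetry
  merges them into \<open>- 2 * (f k + f (k + 1))\<close>.\<close>

lemma sgn_abs_pbin_diff:
  assumes n: "2 * n = real K" and N: "N = n - real i" "N \<ge> 1" and k: "k \<in> unit_steps n" "k > 0"
  shows "(\<Sum>y\<in>unit_steps n. sgn (k - \<bar>y\<bar>) * (pbin N y - pbin (N - 1) y)) = - 2 * k * pbin N k / N"
proof -
  let ?X = "unit_steps n" and ?f = "pbin_step N"
  have fin: "finite ?X" using n by (rule finite_unit_steps)
  have "(\<Sum>y\<in>?X. sgn (k - \<bar>y\<bar>) * (pbin N y - pbin (N - 1) y)) =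
    (\<Sum>y\<in>?X. sgn (k - \<bar>y\<bar>) * (?f y - ?f (y + 1)))"
    by (simp add: pbin_diff[OF N(2)])
  also have "\<dots> = (\<Sum>y\<in>?X. ?f y * (sgn (k - \<bar>y\<bar>) - sgn (k - \<bar>y - 1\<bar>)))"
    using pbin_step_boundary[of n i] unfolding N(1)[symmetric]
    by (intro sum_by_parts_unit_steps[OF n]) auto
  also have "\<dots> = (\<Sum>y\<in>?X. (if y = - k then ?f y else 0) + (if y = 1 - k then ?f y else 0)
       - (if y = k then ?f y else 0) - (if y = k + 1 then ?f y else 0))"
    using unit_steps_diff_Ints[OF n _ k(1)] k(2)
    by (intro sum.cong refl) (simp add: sgn_abs_jump algebra_simps del: Groups.add_ac)
  also have "\<dots> = ?f (- k) + ?f (1 - k) - ?f k - (if k + 1 \<in> ?X then ?f (k + 1) else 0)"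
  proof -
    have "k + n \<in> \<int>" "2 * n \<in> \<int>" "k \<le> n" using k n by (auto simp: unit_steps_def)
    then have "2 * n - (k + n) \<in> \<int>" "2 * n - (k + n) + 1 \<in> \<int>" by (blast intro: Ints_diff Ints_add Ints_1)+
    moreover have "k + (k + n) - (k+n) = k" by simp
    moreover have "1 - k \<le> n"
    proof (rule ccontr)
      assume "\<not> 1 - k \<le> n"
      then have "k + n > 0" "k + n < 1" using k \<open>k \<le> n\<close> by auto
      then show False using \<open>k + n \<in> \<int>\<close> by (auto elim!: Ints_cases)
    qed
    ultimately have "- k \<in> ?X" "1 - k \<in> ?X" using k by (auto simp: unit_steps_def algebra_simps)
    then show ?thesis using k fin by (simp add: sum.distrib sum_subtractf)
  qed
  also have "(if k + 1 \<in> ?X then ?f (k + 1) else 0) = ?f (k + 1)"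
  proof (cases "k = n")
    case True
    then show ?thesis using pbin_step_boundary(2)[of n i] N(1) by simp
  next
    case False
    have "k + n \<in> \<int>" "k \<le> n" using k by (auto simp: unit_steps_def)
    then obtain z where z: "k + n = of_int z" by (auto elim: Ints_cases)
    then have "of_int z < real K" using False \<open>k \<le> n\<close> n by linarith
    then have "z + 1 \<le> int K" by linarith
    then have "of_int z + 1 \<le> real K" by linarith
    then have "k + 1 \<le> n" using z n by linarith
    moreover have "k + 1 + n \<in> \<int>" using \<open>k + n \<in> \<int>\<close> by (metis Ints_1 Ints_add add.assoc add.commute)
    ultimately show ?thesis using k by (auto simp: unit_steps_def)
  qed
  also have "?f (- k) = - ?f (k + 1)" using pbin_step_reflect[of N "k + 1"] by simp
  also have "?f (1 - k) = - ?f k" by (rule pbin_step_reflect)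
  finally show ?thesis using pbin_step_add[OF N(2), of k] by simp
qed


lemma unit_steps_minus: "2 * n = real K \<Longrightarrow> k \<in> unit_steps n \<Longrightarrow> - k \<in> unit_steps n"
proof -
  assume n: "2 * n = real K" and k: "k \<in> unit_steps n"
  have "2 * n - (k + n) \<in> \<int>" using n k by (intro Ints_diff) (auto simp: unit_steps_def)
  then show "- k \<in> unit_steps n" using k by (auto simp: unit_steps_def algebra_simps)
qed

text \<open>The summand without the absolute value telescopes, with antiderivative \<open>t\<close> below, so that only the
  sign change of \<open>k\<close> in the middle of the range contributes.\<close>

lemma sum_abs_rbin_rbin:
  assumes n: "2 * n = real K" and M: "M = n - real i" and N: "N = n - real j" and pos: "M + N > 0"
  shows "0 \<in> unit_steps n \<Longrightarrow>
      (\<Sum>k\<in>unit_steps n. \<bar>k\<bar> * (rbin M k * rbin N k)) = M * N / (M + N) * (rbin M 0 * rbin N 0)"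
    and "1/2 \<in> unit_steps n \<Longrightarrow> (\<Sum>k\<in>unit_steps n. \<bar>k\<bar> * (rbin M k * rbin N k)) =
      (M + 1/2) * (N + 1/2) / (M + N) * (rbin M (1/2) * rbin N (1/2))"
proof -
  let ?X = "unit_steps n"
  have fin: "finite ?X" using n by (rule finite_unit_steps)
  define t where "t k = ((M + k) * rbin M k) * ((N + k) * rbin N k) / (2 * (M + N))" for k
  have t_plus1: "t (k + 1) = ((M - k) * rbin M k) * ((N - k) * rbin N k) / (2 * (M + N))" for k
    using rbin_plus1[of M k] rbin_plus1[of N k] by (simp only: t_def add.assoc[symmetric])
  have step: "\<bar>k\<bar> * (rbin M k * rbin N k) = sgn k * (t k - t (k + 1))" for k
  proof -
    have "t k - t (k + 1) = ((M + k) * (N + k) - (M - k) * (N - k)) * (rbin M k * rbin N k) / (2 * (M + N))"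
      unfolding t_plus1 unfolding t_def diff_divide_distrib[symmetric]
      by (intro arg_cong2[where f = "(/)"] refl) (simp add: algebra_simps)
    also have "(M + k) * (N + k) - (M - k) * (N - k) = k * (2 * (M + N))" by (simp add: algebra_simps)
    finally have "t k - t (k + 1) = k * (rbin M k * rbin N k)" using pos by simp
    then show ?thesis by (simp add: abs_sgn)
  qed
  have ends: "t (- n) = 0" "t (n + 1) = 0"
    using rbin_boundary[of n i] rbin_boundary[of n j] unfolding t_def M N by auto
  have parts: "(\<Sum>k\<in>?X. \<bar>k\<bar> * (rbin M k * rbin N k)) = (\<Sum>k\<in>?X. t k * (sgn k - sgn (k - 1)))"
    unfolding step by (rule sum_by_parts_unit_steps[OF n ends])
  show "(\<Sum>k\<in>?X. \<bar>k\<bar> * (rbin M k * rbin N k)) = M * N / (M + N) * (rbin M 0 * rbin N 0)"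
    if 0: "0 \<in> ?X"
  proof -
    have "sgn k - sgn (k - 1) = of_bool (k = 0) + of_bool (k = 1)" if "k \<in> ?X" for k
    proof -
      have "k \<in> \<int>" using unit_steps_diff_Ints(1)[OF n that 0] by simp
      then obtain z where "k = of_int z" by (auto elim: Ints_cases)
      moreover have "sgn (of_int z) - sgn (of_int z - 1 :: real) = of_bool (z = 0) + of_bool (z = 1)"
        by (auto simp: sgn_if)
      ultimately show ?thesis by simp
    qed
    then have "(\<Sum>k\<in>?X. t k * (sgn k - sgn (k - 1))) =
       (\<Sum>k\<in>?X. (if k = 0 then t k else 0) + (if k = 1 then t k else 0))"
      by (intro sum.cong) auto
    moreover have "1 \<in> ?X"
    proof -
      have "n \<in> \<int>" using 0 by (simp add: unit_steps_def)
      moreover have "n > 0" using pos M N by linarith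
      ultimately have "n \<ge> 1" "1 + n \<in> \<int>" by (auto elim!: Ints_cases)
      then show ?thesis by (simp add: unit_steps_def)
    qed
    ultimately have "(\<Sum>k\<in>?X. t k * (sgn k - sgn (k - 1))) = t 0 + t 1"
      using fin 0 by (simp add: sum.distrib)
    also have "t 1 = t 0" using t_plus1[of 0] by (simp add: t_def)
    also have "t 0 + t 0 = 2 * t 0" by simp
    also have "\<dots> = ((M + 0) * rbin M 0) * ((N + 0) * rbin N 0) / (M + N)"
      unfolding t_def times_divide_eq_right by (rule mult_divide_mult_cancel_left) simp
    also have "\<dots> = M * N / (M + N) * (rbin M 0 * rbin N 0)" by simp
    finally show ?thesis unfolding parts .
  qed
  show "(\<Sum>k\<in>?X. \<bar>k\<bar> * (rbin M k * rbin N k)) =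
      (M + 1/2) * (N + 1/2) / (M + N) * (rbin M (1/2) * rbin N (1/2))" if half: "1/2 \<in> ?X"
  proof -
    have "sgn k - sgn (k - 1) = 2 * of_bool (k = 1/2)" if "k \<in> ?X" for k
    proof -
      have "k - 1/2 \<in> \<int>" using unit_steps_diff_Ints(1)[OF n that half] .
      then obtain z where z: "k - 1/2 = of_int z" by (auto elim: Ints_cases)
      then have k: "k = of_int z + 1/2" by simp
      consider "z \<le> - 1" | "z = 0" | "z \<ge> 1" by linarith
      then show ?thesis
      proof cases
        case 1
        then have "real_of_int z \<le> - 1" by simp
        then show ?thesis unfolding k by (simp add: sgn_if)
      next
        case 3
        then have "real_of_int z \<ge> 1" by simp
        then show ?thesis unfolding k by (simp add: sgn_if)
      qed (simp add: k sgn_if)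
    qed
    then have "(\<Sum>k\<in>?X. t k * (sgn k - sgn (k - 1))) = (\<Sum>k\<in>?X. if k = 1/2 then 2 * t k else 0)"
      by (intro sum.cong) auto
    also have "\<dots> = 2 * t (1/2)"
      using half by (simp only: sum.delta[OF fin] if_True)
    also have "\<dots> = ((M + 1/2) * rbin M (1/2)) * ((N + 1/2) * rbin N (1/2)) / (M + N)"
      unfolding t_def times_divide_eq_right by (rule mult_divide_mult_cancel_left) simp
    also have "\<dots> = (M + 1/2) * (N + 1/2) / (M + N) * (rbin M (1/2) * rbin N (1/2))" by simp
    finally show ?thesis unfolding parts .
  qed
qed

text \<open>The lattice point \<open>0\<close>, present only for integral \<open>n\<close>, is its own mirror image and violates the
  pattern of the other points; this causes the last term, and with it the difference between the
  integral and the half-integral case from here on.\<close>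

lemma sgn_pair_pbin_diff:
  assumes n: "2 * n = real K" and N: "N = n - real j" "N \<ge> 1"
  shows "sgn_pair (unit_steps n) abs p (\<lambda>k. pbin N k - pbin (N - 1) k) =
    - 2 / N * (\<Sum>k\<in>unit_steps n. \<bar>k\<bar> * (p k * pbin N k))
     + (if 0 \<in> unit_steps n then p 0 * (pbin N 0 - pbin (N - 1) 0) else 0)"
proof -
  let ?X = "unit_steps n" and ?q = "\<lambda>k. pbin N k - pbin (N - 1) k"
  have fin: "finite ?X" using n by (rule finite_unit_steps)
  have inner: "(\<Sum>y\<in>?X. sgn (\<bar>x\<bar> - \<bar>y\<bar>) * ?q y) =
     - 2 * \<bar>x\<bar> * pbin N x / N + (if x = 0 then ?q 0 else 0)" if x: "x \<in> ?X" for x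
  proof (cases "x = 0")
    case False
    have "\<bar>x\<bar> \<in> ?X" using unit_steps_minus[OF n x] x by (simp add: abs_if)
    moreover have "pbin N \<bar>x\<bar> = pbin N x" by (simp add: pbin_def abs_if)
    ultimately show ?thesis using sgn_abs_pbin_diff[OF n N, of "\<bar>x\<bar>"] False by simp
  next
    case True
    have jump: "sgn (0 - \<bar>y\<bar>) - sgn (0 - \<bar>y - 1\<bar>) = of_bool (y = 0) * 1 - of_bool (y = 1)" if "y \<in> ?X" for y
      by (auto simp: sgn_if)
    have "(\<Sum>y\<in>?X. sgn (0 - \<bar>y\<bar>) * ?q y) =
      (\<Sum>y\<in>?X. sgn (0 - \<bar>y\<bar>) * (pbin_step N y - pbin_step N (y + 1)))"
      by (simp add: pbin_diff[OF N(2)])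
    also have "\<dots> = (\<Sum>y\<in>?X. pbin_step N y * (sgn (0 - \<bar>y\<bar>) - sgn (0 - \<bar>y - 1\<bar>)))"
      using pbin_step_boundary[of n j] unfolding N(1)[symmetric]
      by (intro sum_by_parts_unit_steps[OF n]) auto
    also have "\<dots> = (\<Sum>y\<in>?X. (if y = 0 then pbin_step N y else 0) - (if y = 1 then pbin_step N y else 0))"
      by (intro sum.cong refl) (simp only: jump, simp add: algebra_simps)
    also have "\<dots> = pbin_step N 0 - pbin_step N 1"
    proof -
      have "n \<in> \<int>" using x True by (simp add: unit_steps_def)
      then have "1 \<in> ?X" using N by (auto simp: unit_steps_def)
      then show ?thesis using x True fin by (simp add: sum_subtractf)
    qed
    also have "\<dots> = ?q 0" using pbin_diff[OF N(2), of 0] by simp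
    finally show ?thesis using True by simp
  qed
  have "sgn_pair ?X abs p ?q = (\<Sum>x\<in>?X. p x * (\<Sum>y\<in>?X. sgn (\<bar>x\<bar> - \<bar>y\<bar>) * ?q y))"
    unfolding sgn_pair_def by (simp add: sum_distrib_left mult_ac)
  also have "\<dots> = (\<Sum>x\<in>?X. - 2 / N * (\<bar>x\<bar> * (p x * pbin N x)) + (if x = 0 then p x * ?q 0 else 0))"
    by (intro sum.cong refl) (simp only: inner, simp add: algebra_simps)
  also have "\<dots> = - 2 / N * (\<Sum>k\<in>?X. \<bar>k\<bar> * (p k * pbin N k)) + (if 0 \<in> ?X then p 0 * ?q 0 else 0)"
    using fin by (simp only: sum.distrib sum_distrib_left) simp
  finally show ?thesis .
qed

lemma sgn_pair_pbin_integer: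
  assumes n: "2 * n = real K" and M: "M = n - real i" "M \<ge> 0" and N: "N = n - real j" "N \<ge> 1"
    and 0: "0 \<in> unit_steps n"
  shows "sgn_pair (unit_steps n) abs (pbin M) (\<lambda>k. pbin N k - pbin (N - 1) k) =
    - (pbin M 0 * pbin N 0) * (2 * M / (M + N) + 1 / (2 * N - 1))"
proof -
  have "(\<Sum>k\<in>unit_steps n. \<bar>k\<bar> * (pbin M k * pbin N k)) =
     bmass M * bmass N * (\<Sum>k\<in>unit_steps n. \<bar>k\<bar> * (rbin M k * rbin N k))"
    unfolding pbin_def sum_distrib_left by (simp add: mult_ac)
  also have "\<dots> = M * N / (M + N) * (pbin M 0 * pbin N 0)"
    using M N by (subst sum_abs_rbin_rbin(1)[OF n M(1) N(1) _ 0]) (simp_all add: pbin_def)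
  finally have 1: "- 2 / N * (\<Sum>k\<in>unit_steps n. \<bar>k\<bar> * (pbin M k * pbin N k))
     = - (pbin M 0 * pbin N 0) * (2 * M / (M + N))"
    using N(2) by simp
  have 2: "pbin N 0 - pbin (N - 1) 0 = - pbin N 0 / (2 * N - 1)"
    unfolding pbin_def rbin_pred bmass_rec[OF N(2)] using N(2) by (simp add: field_simps power2_eq_square)
  show ?thesis
    unfolding sgn_pair_pbin_diff[OF n N] 1 2 using 0 by (simp add: algebra_simps)
qed

lemma sgn_pair_pbin_half_integer:
  assumes n: "2 * n = real K" and M: "M = n - real i" "M \<ge> 0" and N: "N = n - real j" "N \<ge> 1"
    and half: "1/2 \<in> unit_steps n"
  shows "sgn_pair (unit_steps n) abs (pbin M) (\<lambda>k. pbin N k - pbin (N - 1) k) =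
    - 2 * ((M + 1/2) * pbin M (1/2)) * ((N + 1/2) * pbin N (1/2)) / (N * (M + N))"
proof -
  have "0 \<notin> unit_steps n"
    using unit_steps_diff_Ints(1)[OF n half, of 0] by (auto elim!: Ints_cases simp: field_simps)
  have "(\<Sum>k\<in>unit_steps n. \<bar>k\<bar> * (pbin M k * pbin N k)) =
     bmass M * bmass N * (\<Sum>k\<in>unit_steps n. \<bar>k\<bar> * (rbin M k * rbin N k))"
    unfolding pbin_def sum_distrib_left by (simp add: mult_ac)
  also have "(\<Sum>k\<in>unit_steps n. \<bar>k\<bar> * (rbin M k * rbin N k)) =
      (M + 1/2) * (N + 1/2) / (M + N) * (rbin M (1/2) * rbin N (1/2))"
    using M N by (intro sum_abs_rbin_rbin(2)[OF n M(1) N(1) _ half]) simp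
  also have "bmass M * bmass N * \<dots> =
     ((M + 1/2) * pbin M (1/2)) * ((N + 1/2) * pbin N (1/2)) / (M + N)"
    by (simp add: pbin_def)
  finally show ?thesis
    unfolding sgn_pair_pbin_diff[OF n N] using \<open>0 \<notin> unit_steps n\<close> by simp
qed

section \<open>Rational functions determined by their zeros\<close>

lemma degree_prod_linear_le:
  fixes f :: "'i \<Rightarrow> real"
  shows "degree (\<Prod>l\<in>I. [:f l, 1:]) \<le> card I"
proof (cases "finite I")
  case True
  have "degree (\<Prod>l\<in>I. [:f l, 1:]) \<le> (\<Sum>l\<in>I. degree [:f l, 1:])"
    using True by (rule degree_prod_sum_le[unfolded o_def])
  also have "\<dots> \<le> (\<Sum>l\<in>I. 1)" by (intro sum_mono) simp
  finally show ?thesis by simp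
qed simp

lemma prod_real_eq_fact:
  "(\<Prod>i\<in>{1..t}. real i) = fact t"
  unfolding fact_prod of_nat_prod by simp

text \<open>The sum \<open>\<Sum>\<^sub>i w i / (x - i + y)\<close> is a rational function of \<open>y\<close> with numerator of degree at most \<open>t\<close>.
  Its \<open>t\<close> prescribed zeros determine it up to a scalar, which relates its value at \<open>y = x\<close> to its
  residue \<open>w 1\<close> at the first pole.\<close>

lemma cauchy_kernel_ratio:
  fixes w :: "nat \<Rightarrow> real" and x :: real
  assumes x: "x > real t + 1/2"
    and roots: "\<And>j. j \<in> {1..t} \<Longrightarrow> (\<Sum>i\<in>{1..Suc t}. w i / (x - real i + (x - real j))) = 0"
    and nz: "\<exists>i\<in>{1..Suc t}. w i \<noteq> 0"
  shows "w 1 \<noteq> 0 \<and> (\<Sum>i\<in>{1..Suc t}. w i / (x - real i + x)) =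
    w 1 * ((fact t)\<^sup>2 / ((\<Prod>i\<in>{1..t}. 2 * x - 1 - real i) * (\<Prod>i\<in>{1..Suc t}. 2 * x - real i)))"
proof -
  define I where "I = {1..Suc t}"
  have I: "finite I" "1 \<in> I" "Suc t \<in> I" "card I = Suc t" by (auto simp: I_def)
  note roots = roots[folded I_def] and nz = nz[folded I_def]
  define m where "m i = x - real i" for i :: nat
  define P where "P y = (\<Prod>l\<in>I. y + m l)" for y
  \<comment> \<open>The numerator after clearing the denominator \<open>P\<close>.\<close>
  define Q where "Q = (\<Sum>i\<in>I. Polynomial.smult (w i) (\<Prod>l\<in>I - {i}. [:m l, 1:]))"
  have pQ: "poly Q y = (\<Sum>i\<in>I. w i * (\<Prod>l\<in>I - {i}. y + m l))" for y
    by (simp add: Q_def poly_sum poly_prod add.commute)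
  have Q_frac: "poly Q y = (\<Sum>i\<in>I. w i / (m i + y)) * P y" if "P y \<noteq> 0" for y
    unfolding pQ sum_distrib_right
  proof (intro sum.cong refl)
    fix i assume i: "i \<in> I"
    have "P y = (y + m i) * (\<Prod>l\<in>I - {i}. y + m l)"
      unfolding P_def using i I(1) by (intro prod.remove)
    then show "w i * (\<Prod>l\<in>I - {i}. y + m l) = w i / (m i + y) * P y"
      using that by (auto simp: add.commute)
  qed
  have Q_pole: "poly Q (- m i) = w i * (\<Prod>l\<in>I - {i}. m l - m i)" if "i \<in> I" for i
  proof -
    have "poly Q (- m i) = (\<Sum>j\<in>{i}. w j * (\<Prod>l\<in>I - {j}. - m i + m l))"
      unfolding pQ using that I(1) by (intro sum.mono_neutral_right) (auto intro!: prod_zero bexI[of _ i])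
    then show ?thesis by simp
  qed
  have "degree Q \<le> t"
    unfolding Q_def
  proof (intro degree_sum_le)
    fix i assume "i \<in> I"
    then have "card (I - {i}) = t" using I by simp
    then show "degree (Polynomial.smult (w i) (\<Prod>l\<in>I - {i}. [:m l, 1:])) \<le> t"
      using degree_prod_linear_le[of m "I - {i}"] by (auto intro: order_trans[OF degree_smult_le])
  qed (use I in simp)
  have inj: "inj_on m {1..t}" by (auto simp: inj_on_def m_def)
  have Ppos: "P y \<noteq> 0" if "y > - m (Suc t)" for y
    unfolding P_def using that by (auto simp: m_def I_def)
  have "poly Q s = 0" if "s \<in> m ` {1..t}" for s
  proof -
    from that obtain j where j: "j \<in> {1..t}" "s = m j" by auto
    then have "s > - m (Suc t)" using x by (auto simp: m_def)
    then show ?thesis using Q_frac[OF Ppos] roots[OF j(1)] j(2) by (simp add: m_def)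
  qed
  moreover have "degree Q \<le> card (m ` {1..t}) + 0"
    using \<open>degree Q \<le> t\<close> inj by (simp add: card_image)
  ultimately obtain D where D: "Q = (\<Prod>s\<in>m ` {1..t}. [:- s, 1:]) * D" "degree D \<le> 0"
    using poly_factor_roots[of "m ` {1..t}" Q 0] by auto
  from D(2) obtain \<alpha> where \<alpha>: "D = [:\<alpha>:]" by (metis degree_0_id le_zero_eq of_nat_0 degree_eq_zeroE)
  have Q_eq: "poly Q y = \<alpha> * (\<Prod>i\<in>{1..t}. y - m i)" for y
    using inj by (simp add: D(1) \<alpha> poly_prod prod.reindex)
  have mdiff: "(\<Prod>l\<in>I - {1}. m l - m 1) = (- 1) ^ t * fact t"
  proof -
    have "I - {1} = Suc ` {1..t}" unfolding I_def by (subst image_Suc_atLeastAtMost) auto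
    then have "(\<Prod>l\<in>I - {1}. m l - m 1) = (\<Prod>i\<in>{1..t}. m (Suc i) - m 1)"
      by (simp only: prod.reindex[OF inj_on_subset[OF inj_Suc subset_UNIV]] o_def)
    also have "\<dots> = (\<Prod>i\<in>{1..t}. (- 1) * real i)"
      by (intro prod.cong) (auto simp: m_def)
    finally show ?thesis unfolding prod.distrib prod_real_eq_fact by simp
  qed
  have "\<alpha> * (\<Prod>i\<in>{1..t}. - m 1 - m i) = w 1 * ((- 1) ^ t * fact t)"
    using Q_pole[OF I(2)] unfolding Q_eq mdiff by simp
  moreover have "(\<Prod>i\<in>{1..t}. - m 1 - m i) = (\<Prod>i\<in>{1..t}. (- 1) * (2 * x - 1 - real i))"
    by (intro prod.cong) (auto simp: m_def)
  ultimately have w1: "\<alpha> * (\<Prod>i\<in>{1..t}. 2 * x - 1 - real i) = w 1 * fact t"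
    unfolding prod.distrib by simp
  have pos1: "(\<Prod>i\<in>{1..t}. 2 * x - 1 - real i) > 0"
    using x by (intro prod_pos) auto
  have "\<alpha> \<noteq> 0"
  proof
    assume "\<alpha> = 0"
    have "w i = 0" if "i \<in> I" for i
    proof -
      have "(\<Prod>l\<in>I - {i}. m l - m i) \<noteq> 0" using I(1) by (auto simp: m_def)
      then show ?thesis using Q_pole[OF that] \<open>\<alpha> = 0\<close> by (simp add: Q_eq)
    qed
    then show False using nz by auto
  qed
  then have "\<alpha> * (\<Prod>i\<in>{1..t}. 2 * x - 1 - real i) \<noteq> 0"
    using pos1 by (metis less_irrefl mult_eq_0_iff)
  then have "w 1 \<noteq> 0" unfolding w1 by (metis mult_zero_left)
  have xp: "x > - m (Suc t)" using x by (simp add: m_def)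
  have Px: "P x = (\<Prod>i\<in>I. 2 * x - real i)" unfolding P_def by (intro prod.cong) (auto simp: m_def)
  have "(\<Prod>i\<in>{1..t}. x - m i) = fact t"
    unfolding prod_real_eq_fact[symmetric] by (simp add: m_def)
  then have "\<alpha> * fact t = (\<Sum>i\<in>I. w i / (m i + x)) * (\<Prod>i\<in>I. 2 * x - real i)"
    using Q_frac[OF Ppos[OF xp]] by (simp only: Q_eq Px)
  moreover have "(\<Prod>i\<in>I. 2 * x - real i) \<noteq> 0" using Ppos[OF xp] unfolding Px .
  ultimately have "(\<Sum>i\<in>I. w i / (m i + x)) = \<alpha> * fact t / (\<Prod>i\<in>I. 2 * x - real i)"
    by (metis nonzero_eq_divide_eq)
  also have "\<alpha> = w 1 * fact t / (\<Prod>i\<in>{1..t}. 2 * x - 1 - real i)"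
    using w1 pos1 by (metis nonzero_eq_divide_eq less_irrefl)
  finally show ?thesis unfolding I_def[symmetric] using \<open>w 1 \<noteq> 0\<close> by (simp add: m_def power2_eq_square)
qed

text \<open>The analogue for integral \<open>n\<close>. The additional pole at \<open>1/2\<close> raises the degree of the numerator by
  one, so the prescribed zeros leave a linear factor \<open>\<beta> + \<gamma> * y\<close> undetermined. The missing condition
  is that the residue at the additional pole is half the sum of the same \<open>w i\<close>: it links the values of
  the numerator at \<open>0\<close> and \<open>1/2\<close>. The linear factor has no simple zero, but its values at \<open>x\<close> and at
  \<open>1 - x\<close> are products.\<close>

lemma cauchy_kernel_ratio_shifted:
  fixes w :: "nat \<Rightarrow> real" and x :: real
  assumes x: "x \<ge> real t + 1" and t: "t \<ge> 1"
    and roots: "\<And>j. j \<in> {1..t} \<Longrightarrow> (\<Sum>i\<in>{1..Suc t}. w i *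
        (2 * (x - real i) / (x - real i + (x - real j)) + 1 / (2 * (x - real j) - 1))) = 0"
    and nz: "\<exists>i\<in>{1..Suc t}. w i \<noteq> 0"
  shows "w 1 \<noteq> 0 \<and> (\<Sum>i\<in>{1..Suc t}. w i * (2 * (x - real i) / (x - real i + x) + 1 / (2 * x - 1))) =
    w 1 * (2 * (x - 1) * (2 * x - 1 - real t) * (fact t)\<^sup>2 /
      ((\<Prod>i\<in>{1..Suc t}. 2 * x - 1 - real i) * (\<Prod>i\<in>{1..Suc t}. 2 * x - real i)))"
proof -
  define I where "I = {1..Suc t}"
  have I: "finite I" "1 \<in> I" "Suc t \<in> I" "card I = Suc t" by (auto simp: I_def)
  note roots = roots[folded I_def] and nz = nz[folded I_def]
  define m where "m i = x - real i" for i :: nat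
  define a where "a = m (Suc t)"
  define Z where "Z = (\<Sum>i\<in>I. w i)"
  define P where "P y = (\<Prod>l\<in>I. y + m l)" for y
  \<comment> \<open>The numerator over the common denominator \<open>(y - 1/2) * P y\<close>.\<close>
  define Q where "Q = (\<Sum>i\<in>I. Polynomial.smult (2 * m i * w i) ([:- (1/2), 1:] * (\<Prod>l\<in>I - {i}. [:m l, 1:])))
     + Polynomial.smult (Z / 2) (\<Prod>l\<in>I. [:m l, 1:])"
  have pQ: "poly Q y = (\<Sum>i\<in>I. 2 * m i * w i * ((y - 1/2) * (\<Prod>l\<in>I - {i}. y + m l))) + Z / 2 * P y" for y
    by (simp add: Q_def P_def poly_sum poly_prod add.commute left_diff_distrib)
  have P_remove: "P y = (y + m i) * (\<Prod>l\<in>I - {i}. y + m l)" if "i \<in> I" for i y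
    unfolding P_def using that I(1) by (intro prod.remove)
  have Q_frac: "poly Q y = (\<Sum>i\<in>I. w i * (2 * m i / (m i + y) + 1 / (2 * y - 1))) * ((y - 1/2) * P y)"
    if "P y \<noteq> 0" "y \<noteq> 1/2" for y
  proof -
    have "2 * m i * w i * ((y - 1/2) * (\<Prod>l\<in>I - {i}. y + m l)) + w i / 2 * P y =
       w i * (2 * m i / (m i + y) + 1 / (2 * y - 1)) * ((y - 1/2) * P y)" if i: "i \<in> I" for i
    proof -
      have ne: "m i + y \<noteq> 0" using P_remove[OF i, of y] \<open>P y \<noteq> 0\<close> by (auto simp: add.commute)
      then have p1: "(\<Prod>l\<in>I - {i}. y + m l) = P y / (m i + y)"
        using P_remove[OF i, of y] by (simp add: add.commute)
      have p2: "w i / 2 * P y = w i * (1 / (2 * y - 1)) * ((y - 1/2) * P y)"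
      proof -
        have "1 / (2 * y - 1) * (y - 1/2) = 1 / 2" using \<open>y \<noteq> 1/2\<close> by (simp add: field_simps)
        then show ?thesis by (metis (no_types, opaque_lifting) mult.assoc times_divide_eq_right mult.right_neutral)
      qed
      have "2 * M * W * (g * (p / q)) + W * (1 / h) * (g * p) = W * (2 * M / q + 1 / h) * (g * p)"
        for M W g p q h :: real by (simp add: algebra_simps)
      then show ?thesis unfolding p1 p2 .
    qed
    then have "(\<Sum>i\<in>I. 2 * m i * w i * ((y - 1/2) * (\<Prod>l\<in>I - {i}. y + m l)) + w i / 2 * P y)
      = (\<Sum>i\<in>I. w i * (2 * m i / (m i + y) + 1 / (2 * y - 1)) * ((y - 1/2) * P y))"
      by (intro sum.cong refl)
    then show ?thesis
      unfolding pQ Z_def by (simp only: sum.distrib sum_distrib_right sum_divide_distrib)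
  qed
  have Q_pole: "poly Q (- m i) = 2 * m i * w i * ((- m i - 1/2) * (\<Prod>l\<in>I - {i}. m l - m i))" if "i \<in> I" for i
  proof -
    have "P (- m i) = 0" using P_remove[OF that, of "- m i"] by simp
    moreover have "(\<Sum>j\<in>I. 2 * m j * w j * ((- m i - 1/2) * (\<Prod>l\<in>I - {j}. - m i + m l)))
       = (\<Sum>j\<in>{i}. 2 * m j * w j * ((- m i - 1/2) * (\<Prod>l\<in>I - {j}. - m i + m l)))"
      using that I(1) by (intro sum.mono_neutral_right) (auto intro!: prod_zero bexI[of _ i])
    ultimately show ?thesis unfolding pQ by simp
  qed
  have Q_half: "poly Q (1/2) = Z / 2 * P (1/2)" unfolding pQ by simp
  have Q_0: "poly Q 0 = - (Z / 2 * P 0)"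
  proof -
    have "2 * m i * w i * ((0 - 1/2) * (\<Prod>l\<in>I - {i}. 0 + m l)) = - (w i * P 0)" if "i \<in> I" for i
      using P_remove[OF that, of 0] by simp
    then have "(\<Sum>i\<in>I. 2 * m i * w i * ((0 - 1/2) * (\<Prod>l\<in>I - {i}. 0 + m l))) = (\<Sum>i\<in>I. - (w i * P 0))"
      by (intro sum.cong refl)
    also have "\<dots> = - (Z * P 0)" by (simp add: Z_def sum_distrib_right sum_negf)
    finally show ?thesis unfolding pQ by simp
  qed
  have deg: "degree Q \<le> Suc t"
    unfolding Q_def
  proof (intro degree_add_le degree_sum_le)
    fix i assume "i \<in> I"
    then have "card (I - {i}) = t" using I by simp
    then have "degree (\<Prod>l\<in>I - {i}. [:m l, 1:]) \<le> t"
      using degree_prod_linear_le[of m "I - {i}"] by simp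
    then have "degree ([:- (1/2), 1:] * (\<Prod>l\<in>I - {i}. [:m l, 1:])) \<le> Suc t"
      by (intro order_trans[OF degree_mult_le]) simp
    then show "degree (Polynomial.smult (2 * m i * w i) ([:- (1/2), 1:] * (\<Prod>l\<in>I - {i}. [:m l, 1:]))) \<le> Suc t"
      by (rule order_trans[OF degree_smult_le])
  next
    show "degree (Polynomial.smult (Z / 2) (\<Prod>l\<in>I. [:m l, 1:])) \<le> Suc t"
      using degree_prod_linear_le[of m I] I by (auto intro: order_trans[OF degree_smult_le])
  qed (use I in simp)
  have inj: "inj_on m {1..t}" by (auto simp: inj_on_def m_def)
  have Ppos: "P y > 0" if "y > 0" for y
    unfolding P_def using that x by (intro prod_pos) (auto simp: m_def I_def)
  have "poly Q s = 0" if "s \<in> m ` {1..t}" for s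
  proof -
    from that obtain j where j: "j \<in> {1..t}" "s = m j" by auto
    then have "s \<ge> 1" using x by (auto simp: m_def)
    then show ?thesis using Q_frac[of s] Ppos[of s] roots[OF j(1)] j(2) by (simp add: m_def)
  qed
  moreover have "degree Q \<le> card (m ` {1..t}) + 1"
    using deg inj by (simp add: card_image)
  ultimately obtain D where D: "Q = (\<Prod>s\<in>m ` {1..t}. [:- s, 1:]) * D" "degree D \<le> 1"
    using poly_factor_roots[of "m ` {1..t}" Q 1] by auto
  define \<beta> \<gamma> where "\<beta> = Polynomial.coeff D 0" and "\<gamma> = Polynomial.coeff D 1"
  have pD: "poly D y = \<beta> + \<gamma> * y" for y
  proof -
    have "D = [:\<beta>, \<gamma>:]"
    proof (rule poly_eqI)
      fix i show "Polynomial.coeff D i = Polynomial.coeff [:\<beta>, \<gamma>:] i"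
        using D(2) by (cases "i \<le> 1") (auto simp: \<beta>_def \<gamma>_def le_Suc_eq coeff_eq_0 coeff_pCons split: nat.splits)
    qed
    then show ?thesis by simp
  qed
  define R where "R y = (\<Prod>i\<in>{1..t}. y - m i)" for y
  have Q_eq: "poly Q y = (\<beta> + \<gamma> * y) * R y" for y
    using inj by (simp add: D(1) poly_prod prod.reindex pD R_def mult.commute)
  have I_last: "I = insert (Suc t) {1..t}" unfolding I_def by auto
  have I_first: "I = insert 1 (Suc ` {1..t})"
    unfolding I_def by (subst image_Suc_atLeastAtMost) auto
  have R0: "P 0 = a * ((- 1) ^ t * R 0)"
  proof -
    have "R 0 = (\<Prod>i\<in>{1..t}. (- 1) * m i)" by (simp add: R_def)
    also have "\<dots> = (- 1) ^ t * (\<Prod>i\<in>{1..t}. m i)" unfolding prod.distrib by simp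
    finally show ?thesis unfolding P_def I_last by (simp add: a_def)
  qed
  have R_half: "P (1/2) = (x - 1/2) * ((- 1) ^ t * R (1/2))"
  proof -
    have "R (1/2) = (\<Prod>i\<in>{1..t}. (- 1) * (1/2 + m (Suc i)))"
      unfolding R_def by (intro prod.cong) (auto simp: m_def)
    also have "\<dots> = (- 1) ^ t * (\<Prod>i\<in>{1..t}. 1/2 + m (Suc i))" unfolding prod.distrib by simp
    finally have "(- 1) ^ t * R (1/2) = (\<Prod>i\<in>{1..t}. 1/2 + m (Suc i))" by simp
    moreover have "P (1/2) = (1/2 + m 1) * (\<Prod>i\<in>{1..t}. 1/2 + m (Suc i))"
      unfolding P_def I_first
      by (subst prod.insert) (auto simp only: prod.reindex[OF inj_on_subset[OF inj_Suc subset_UNIV]] o_def, auto)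
    ultimately show ?thesis by (simp add: m_def)
  qed
  have R0_ne: "R 0 \<noteq> 0" using x by (auto simp: R_def m_def)
  have Rh_ne: "R (1/2) \<noteq> 0" using x by (auto simp: R_def m_def)
  have b0: "\<beta> = - (Z / 2 * (a * (- 1) ^ t))"
  proof -
    have "\<beta> * R 0 = - (Z / 2 * (a * (- 1) ^ t)) * R 0"
      using Q_0 unfolding Q_eq R0 by (simp add: mult_ac)
    then show ?thesis using R0_ne by (metis mult_right_cancel)
  qed
  have bh: "\<beta> + \<gamma> / 2 = Z / 2 * ((x - 1/2) * (- 1) ^ t)"
  proof -
    have "(\<beta> + \<gamma> / 2) * R (1/2) = Z / 2 * ((x - 1/2) * (- 1) ^ t) * R (1/2)"
      using Q_half unfolding Q_eq R_half by (simp add: mult_ac)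
    then show ?thesis using Rh_ne by (metis mult_right_cancel)
  qed
  define \<alpha> where "\<alpha> = Z / 2 * (- 1) ^ t"
  have coeffs: "\<beta> = - \<alpha> * a" "\<gamma> = \<alpha> * (2 * x - 1 + 2 * a)"
    using b0 bh by (simp_all add: \<alpha>_def algebra_simps)
  have "\<alpha> \<noteq> 0"
  proof
    assume "\<alpha> = 0"
    then have "Z = 0" "poly Q y = 0" for y by (auto simp: \<alpha>_def Q_eq coeffs)
    \<comment> \<open>At most one \<open>m i\<close> vanishes, and that \<open>w i\<close> is then detected by \<open>Z\<close>.\<close>
    have mw: "m i * w i = 0" if "i \<in> I" for i
    proof -
      have "m i \<ge> 0" using that x by (auto simp: m_def I_def)
      moreover have "(\<Prod>l\<in>I - {i}. m l - m i) \<noteq> 0" using I(1) by (auto simp: m_def)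
      ultimately show ?thesis using Q_pole[OF that] \<open>poly Q (- m i) = 0\<close> by auto
    qed
    obtain i where i: "i \<in> I" "w i \<noteq> 0" using nz by auto
    have "w l = 0" if "l \<in> I" "l \<noteq> i" for l
    proof -
      have "m i = 0" using mw[OF i(1)] i(2) by simp
      then have "m l \<noteq> 0" using that(2) by (auto simp: m_def)
      then show ?thesis using mw[OF that(1)] by simp
    qed
    then have "Z = (\<Sum>l\<in>{i}. w l)" unfolding Z_def using i(1) I(1) by (intro sum.mono_neutral_right) auto
    then show False using i(2) \<open>Z = 0\<close> by simp
  qed
  have mdiff: "(\<Prod>l\<in>I - {1}. m l - m 1) = (- 1) ^ t * fact t"
  proof -
    have "I - {1} = Suc ` {1..t}" unfolding I_first by auto
    then have "(\<Prod>l\<in>I - {1}. m l - m 1) = (\<Prod>i\<in>{1..t}. m (Suc i) - m 1)"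
      by (simp only: prod.reindex[OF inj_on_subset[OF inj_Suc subset_UNIV]] o_def)
    also have "\<dots> = (\<Prod>i\<in>{1..t}. (- 1) * real i)"
      by (intro prod.cong) (auto simp: m_def)
    finally show ?thesis unfolding prod.distrib prod_real_eq_fact by simp
  qed
  have a: "a = x - 1 - real t" by (simp add: a_def m_def)
  have R_pole: "R (- m 1) = (- 1) ^ t * (\<Prod>i\<in>{1..t}. 2 * x - 1 - real i)"
  proof -
    have "R (- m 1) = (\<Prod>i\<in>{1..t}. (- 1) * (2 * x - 1 - real i))"
      unfolding R_def by (intro prod.cong) (auto simp: m_def)
    then show ?thesis unfolding prod.distrib by simp
  qed
  have "(\<beta> + \<gamma> * (- m 1)) * R (- m 1) = 2 * m 1 * w 1 * ((- m 1 - 1/2) * ((- 1) ^ t * fact t))"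
    using Q_pole[OF I(2)] unfolding Q_eq mdiff by simp
  then have "(\<beta> + \<gamma> * (- m 1)) * (\<Prod>i\<in>{1..t}. 2 * x - 1 - real i) = 2 * m 1 * w 1 * (- m 1 - 1/2) * fact t"
    unfolding R_pole by (simp add: mult_ac)
  moreover have "\<beta> + \<gamma> * (- m 1) = - (\<alpha> * (2 * x - 1) * (2 * x - 1 - real (Suc t)))"
    unfolding coeffs a by (simp add: m_def algebra_simps)
  moreover have "2 * m 1 * w 1 * (- m 1 - 1/2) * fact t = - ((2 * x - 1) * ((x - 1) * w 1 * fact t))"
    by (simp add: m_def field_simps)
  ultimately have "(2 * x - 1) * (\<alpha> * (\<Prod>i\<in>I. 2 * x - 1 - real i)) = (2 * x - 1) * ((x - 1) * w 1 * fact t)"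
    unfolding I_last by (simp add: mult_ac)
  then have w1: "\<alpha> * (\<Prod>i\<in>I. 2 * x - 1 - real i) = (x - 1) * w 1 * fact t"
    using x by simp
  have pos1: "(\<Prod>i\<in>I. 2 * x - 1 - real i) > 0"
    using x t by (intro prod_pos) (auto simp: I_def)
  then have "\<alpha> * (\<Prod>i\<in>I. 2 * x - 1 - real i) \<noteq> 0"
    using \<open>\<alpha> \<noteq> 0\<close> by (metis less_irrefl mult_eq_0_iff)
  then have "w 1 \<noteq> 0" unfolding w1 by (metis mult_zero_left mult_zero_right)
  have Px: "P x = (\<Prod>i\<in>I. 2 * x - real i)" unfolding P_def by (intro prod.cong) (auto simp: m_def)
  have "R x = fact t"
    unfolding prod_real_eq_fact[symmetric] by (simp add: R_def m_def)
  moreover have "\<beta> + \<gamma> * x = \<alpha> * (2 * x - 1) * (2 * x - 1 - real t)"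
    unfolding coeffs a by (simp add: algebra_simps)
  moreover have "P x > 0" using Ppos x by simp
  ultimately have eq: "\<alpha> * (2 * x - 1) * (2 * x - 1 - real t) * fact t =
      (\<Sum>i\<in>I. w i * (2 * m i / (m i + x) + 1 / (2 * x - 1))) * ((x - 1/2) * (\<Prod>i\<in>I. 2 * x - real i))"
    using Q_frac[of x] x t by (simp add: Q_eq Px[symmetric])
  have ne: "(\<Prod>i\<in>I. 2 * x - real i) \<noteq> 0" "2 * x - 1 \<noteq> 0"
    using \<open>P x > 0\<close> x unfolding Px by simp_all
  have solve: "S = 2 * u * c * f / p" if "u * h * c * f = S * ((h / 2) * p)" "p \<noteq> 0" "h \<noteq> 0"
    for S u c f p h :: real
  proof -
    have "h * (S * p) = h * (2 * u * c * f)" using that(1) by (auto simp: mult_ac)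
    then have "S * p = 2 * u * c * f" using mult_left_cancel[OF that(3)] by blast
    then show ?thesis using that(2) by (simp add: nonzero_eq_divide_eq)
  qed
  have "x - 1/2 = (2 * x - 1) / 2" by simp
  from eq[unfolded this] ne have "(\<Sum>i\<in>I. w i * (2 * m i / (m i + x) + 1 / (2 * x - 1))) =
      2 * \<alpha> * (2 * x - 1 - real t) * fact t / (\<Prod>i\<in>I. 2 * x - real i)"
    by (rule solve)
  also have "\<alpha> = (x - 1) * w 1 * fact t / (\<Prod>i\<in>I. 2 * x - 1 - real i)"
    using w1 pos1 by (metis nonzero_eq_divide_eq less_irrefl)
  also have "2 * ((x - 1) * w 1 * fact t / p) * c * fact t / q = w 1 * (2 * (x - 1) * c * (fact t)\<^sup>2 / (p * q))"
    for p q c :: real by (simp add: power2_eq_square)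
  finally show ?thesis
    unfolding I_def[symmetric] using \<open>w 1 \<noteq> 0\<close> unfolding m_def by (intro conjI)
qed

lemma sgn_pair_diff_right:
  "sgn_pair X \<kappa> p (\<lambda>k. q k - q' k) = sgn_pair X \<kappa> p q - sgn_pair X \<kappa> p q'"
  unfolding sgn_pair_def by (simp add: right_diff_distrib sum_subtractf)

lemma sgn_sum_reindex:
  assumes "strict_mono f"
  shows "sgn_sum X \<kappa> (f ` A) g = sgn_sum X \<kappa> A (\<lambda>i. g (f i))"
proof -
  have inj: "inj_on f A" using assms by (metis inj_on_subset strict_mono_imp_inj_on subset_UNIV)
  have vand: "sgn_vand (f ` A) x = sgn_vand A (\<lambda>i. x (f i))" for x
    unfolding sgn_vand_def using inj assms by (simp add: prod.reindex strict_mono_less)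
  note bij = bij_betw_PiE_reindex[OF inj, of X]
  show ?thesis
    unfolding sgn_sum_def sum.reindex_bij_betw[OF bij, symmetric] vand
    using inj by (intro sum.cong refl arg_cong2[where f = "(*)"] sgn_vand_cong) (simp_all add: prod.reindex)
qed

section \<open>The recurrence in the number of variables\<close>

text \<open>The sign sum of the consecutive distributions with parameters \<open>x, x - 1, \<dots>, x - r + 1\<close>. The
  lattice, given by \<open>n\<close>, stays fixed while the recurrence lowers \<open>x\<close>.\<close>

definition pbin_pf :: "real \<Rightarrow> nat \<Rightarrow> real \<Rightarrow> real" where
  "pbin_pf n r x = sgn_sum (unit_steps n) abs {..<r} (\<lambda>i. pbin (x - real i))"

abbreviation diff_pair :: "real \<Rightarrow> real \<Rightarrow> real \<Rightarrow> real" where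
  "diff_pair n M N \<equiv> sgn_pair (unit_steps n) abs (pbin M) (\<lambda>k. pbin N k - pbin (N - 1) k)"

text \<open>With \<open>c\<close> the bordered kernel vector for the parameters \<open>x - 1, \<dots>, x - t - 1\<close>, the combination pairs
  to the same constant with each of these distributions, hence to zero with their consecutive
  differences; the pairing with the distribution of parameter \<open>x\<close> exceeds the constant by the pairing
  with one more difference.\<close>

lemma pbin_pf_two_step:
  assumes n: "2 * n = real K" and x: "x = n - real s" "x \<ge> real t + 1"
  obtains c where "\<exists>i\<in>{1..Suc t}. c i \<noteq> 0"
    "\<forall>j\<in>{1..t}. (\<Sum>i\<in>{1..Suc t}. c i * diff_pair n (x - real i) (x - real j)) = 0"
    "\<bar>c 1\<bar> * \<bar>pbin_pf n (Suc (Suc t)) x\<bar> =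
      \<bar>\<Sum>i\<in>{1..Suc t}. c i * diff_pair n (x - real i) x\<bar> * \<bar>pbin_pf n t (x - 2)\<bar>"
proof -
  let ?X = "unit_steps n"
  define I where "I = {1..Suc t}"
  define g where "g i = pbin (x - real i)" for i
  have I: "finite I" "I \<noteq> {}" "card I = Suc t" by (auto simp: I_def)
  have "\<exists>c C. (\<exists>i\<in>I. c i \<noteq> 0) \<and> (\<forall>j\<in>I. (\<Sum>i\<in>I. c i * sgn_pair ?X abs (g i) (g j)) = C) \<and>
    (odd (card I) \<longrightarrow> C = 0) \<and> (even (card I) \<longrightarrow> (\<Sum>i\<in>I. c i) = 0)"
    by (intro antisymmetric_bordered_kernel I sgn_pair_antisym)
  then obtain c C where c: "\<exists>i\<in>I. c i \<noteq> 0" "\<forall>j\<in>I. (\<Sum>i\<in>I. c i * sgn_pair ?X abs (g i) (g j)) = C"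
    "odd (card I) \<longrightarrow> C = 0" "even (card I) \<longrightarrow> (\<Sum>i\<in>I. c i) = 0"
    by (elim exE conjE)
  define z where "z = (\<lambda>k. \<Sum>i\<in>I. c i * g i k)"
  have zg: "sgn_pair ?X abs z (g j) = C" if "j \<in> I" for j
    unfolding z_def sgn_pair_sum_left using c(2) that by blast
  have diff: "(\<Sum>i\<in>I. c i * diff_pair n (x - real i) (x - real j)) = sgn_pair ?X abs z (g j) - sgn_pair ?X abs z (g (Suc j))" for j
  proof -
    have "x - real (Suc j) = x - real j - 1" by simp
    then have "sgn_pair ?X abs z (g j) - sgn_pair ?X abs z (g (Suc j)) =
       sgn_pair ?X abs z (\<lambda>k. pbin (x - real j) k - pbin (x - real j - 1) k)"
      unfolding sgn_pair_diff_right g_def by (simp only:)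
    then show ?thesis unfolding z_def sgn_pair_sum_left g_def by simp
  qed
  have total: "(\<Sum>k\<in>?X. g i k) = 1" if "i \<in> {..<Suc (Suc t)}" for i
  proof -
    have e: "x - real i = n - real (s + i)" and le: "real (s + i) \<le> n" using that x by auto
    show ?thesis unfolding g_def e by (rule pbin_total[OF n le])
  qed
  have set: "{..<Suc (Suc t)} - {0} = I" by (auto simp: I_def)
  have "\<bar>c 1\<bar> * \<bar>sgn_sum ?X abs {..<Suc (Suc t)} g\<bar> =
    \<bar>sgn_pair ?X abs z (g 0) - C\<bar> * \<bar>sgn_sum ?X abs ({..<Suc (Suc t)} - {1, 0}) g\<bar>"
  proof (rule sgn_sum_two_step)
    show "z = (\<lambda>k. \<Sum>i\<in>{..<Suc (Suc t)} - {0}. c i * g i k)" unfolding set z_def ..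
    show "sgn_pair ?X abs z (g j) = C" if "j \<in> {..<Suc (Suc t)} - {1, 0}" for j
      using that by (intro zg) (auto simp: I_def)
    show "C = 0" if "even (card {..<Suc (Suc t)})" using c(3) that I(3) by simp
    show "(\<Sum>i\<in>{..<Suc (Suc t)} - {0}. c i) = 0" if "odd (card {..<Suc (Suc t)})"
      unfolding set using c(4) that I(3) by simp
  qed (use total in auto)
  moreover have "sgn_pair ?X abs z (g 0) - C = (\<Sum>i\<in>I. c i * diff_pair n (x - real i) x)"
    using diff[of 0] zg[of 1] by (simp add: I_def)
  moreover have "sgn_sum ?X abs ({..<Suc (Suc t)} - {1, 0}) g = pbin_pf n t (x - 2)"
  proof -
    have "{..<Suc (Suc t)} - {1, 0} = (\<lambda>i. Suc (Suc i)) ` {..<t}"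
    proof (intro Set.set_eqI iffI)
      fix i assume "i \<in> {..<Suc (Suc t)} - {1, 0}"
      then show "i \<in> (\<lambda>i. Suc (Suc i)) ` {..<t}" by (intro image_eqI[of _ _ "i - 2"]) auto
    qed auto
    moreover have "strict_mono (\<lambda>i. Suc (Suc i))" by (auto simp: strict_mono_def)
    moreover have "g (Suc (Suc i)) = pbin (x - 2 - real i)" for i
      unfolding g_def by (rule arg_cong[where f = pbin]) simp
    ultimately show ?thesis by (simp add: sgn_sum_reindex pbin_pf_def)
  qed
  moreover have "sgn_sum ?X abs {..<Suc (Suc t)} g = pbin_pf n (Suc (Suc t)) x"
    by (simp add: pbin_pf_def g_def[abs_def])
  ultimately have step: "\<bar>c 1\<bar> * \<bar>pbin_pf n (Suc (Suc t)) x\<bar> =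
      \<bar>\<Sum>i\<in>I. c i * diff_pair n (x - real i) x\<bar> * \<bar>pbin_pf n t (x - 2)\<bar>" by simp
  show ?thesis
  proof (rule that[of c])
    show "\<exists>i\<in>{1..Suc t}. c i \<noteq> 0" using c(1) unfolding I_def .
    have "(\<Sum>i\<in>I. c i * diff_pair n (x - real i) (x - real j)) = 0" if "j \<in> {1..t}" for j
    proof -
      have "j \<in> I" "Suc j \<in> I" using that by (auto simp: I_def)
      then show ?thesis unfolding diff using zg by simp
    qed
    then show "\<forall>j\<in>{1..t}. (\<Sum>i\<in>{1..Suc t}. c i * diff_pair n (x - real i) (x - real j)) = 0"
      unfolding I_def by blast
  qed (use step in \<open>simp only: I_def\<close>)
qed

text \<open>For natural \<open>j\<close> this is \<open>binomial (2 * j) j / 4 ^ j\<close>.\<close>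

definition central_bin :: "real \<Rightarrow> real" where
  "central_bin j = Gamma (j + 1/2) / (sqrt pi * Gamma (j + 1))"

lemma pbin_centre:
  "x > - 1 \<Longrightarrow> pbin x 0 = central_bin x"
  "x > - 1/2 \<Longrightarrow> (x + 1/2) * pbin x (1/2) = Gamma (x + 1) / (sqrt pi * Gamma (x + 1/2))"
proof -
  assume x: "x > - 1"
  have "Gamma (x + 1) > 0" using x by (simp add: Gamma_real_pos)
  then show "pbin x 0 = central_bin x"
    by (simp add: pbin_def bmass_def rbin_def rGamma_inverse_Gamma central_bin_def add.commute field_simps)
next
  assume x: "x > - 1/2"
  have g: "Gamma (x + 1/2) > 0" using x by (simp add: Gamma_real_pos)
  have "(x + 1/2) * rGamma (x + 1/2 + 1) = rGamma (x + 1/2)" by (rule rGamma_plus1)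
  moreover have "1 + x + 1/2 = x + 1/2 + 1" "1 + x - 1/2 = x + 1/2" by simp_all
  ultimately have "(x + 1/2) * rbin x (1/2) = rGamma (x + 1/2) * rGamma (x + 1/2)"
    unfolding rbin_def by (simp only: mult.assoc[symmetric])
  then have "(x + 1/2) * pbin x (1/2) = bmass x * (rGamma (x + 1/2) * rGamma (x + 1/2))"
    unfolding pbin_def by (simp only: mult.left_commute[of _ "bmass x"])
  then show "(x + 1/2) * pbin x (1/2) = Gamma (x + 1) / (sqrt pi * Gamma (x + 1/2))"
    using g by (simp add: bmass_def rGamma_inverse_Gamma field_simps)
qed

lemma central_bin_pos: "x > - 1/2 \<Longrightarrow> central_bin x > 0"
  by (simp add: central_bin_def Gamma_real_pos)

text \<open>The values \<open>c i * central_bin (x - i)\<close> are the residues, up to known factors, of the rational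
  function whose zeros are supplied by the two-step reduction.\<close>

lemma pbin_pf_recurrence_integer:
  assumes n: "2 * n = real K" and x: "x = n - real s" "x \<ge> real t + 1" and t: "t \<ge> 1"
    and 0: "0 \<in> unit_steps n"
  shows "\<bar>pbin_pf n (Suc (Suc t)) x\<bar> = central_bin x * central_bin (x - 1) *
    (2 * (x - 1) * (2 * x - 1 - real t) * (fact t)\<^sup>2 /
      ((\<Prod>i\<in>{1..Suc t}. 2 * x - 1 - real i) * (\<Prod>i\<in>{1..Suc t}. 2 * x - real i))) * \<bar>pbin_pf n t (x - 2)\<bar>"
proof -
  obtain c where c: "\<exists>i\<in>{1..Suc t}. c i \<noteq> 0"
    "\<forall>j\<in>{1..t}. (\<Sum>i\<in>{1..Suc t}. c i * diff_pair n (x - real i) (x - real j)) = 0"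
    "\<bar>c 1\<bar> * \<bar>pbin_pf n (Suc (Suc t)) x\<bar> =
      \<bar>\<Sum>i\<in>{1..Suc t}. c i * diff_pair n (x - real i) x\<bar> * \<bar>pbin_pf n t (x - 2)\<bar>"
    using pbin_pf_two_step[OF n x] by blast
  define w where "w i = c i * central_bin (x - real i)" for i
  have pair: "(\<Sum>i\<in>{1..Suc t}. c i * diff_pair n (x - real i) (x - real j)) =
    - central_bin (x - real j) * (\<Sum>i\<in>{1..Suc t}. w i *
        (2 * (x - real i) / (x - real i + (x - real j)) + 1 / (2 * (x - real j) - 1)))" if "j \<le> t" for j
    unfolding sum_distrib_left
  proof (intro sum.cong refl)
    fix i assume "i \<in> {1..Suc t}"
    then have i: "x - real i \<ge> 0" using x by auto
    have "diff_pair n (x - real i) (x - real j) = - (pbin (x - real i) 0 * pbin (x - real j) 0) *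
        (2 * (x - real i) / (x - real i + (x - real j)) + 1 / (2 * (x - real j) - 1))"
      using i that x by (intro sgn_pair_pbin_integer[OF n _ _ _ _ 0, of _ "s + i" _ "s + j"]) auto
    moreover have "pbin (x - real i) 0 = central_bin (x - real i)" "pbin (x - real j) 0 = central_bin (x - real j)"
      using i that x by (intro pbin_centre; linarith)+
    ultimately show "c i * diff_pair n (x - real i) (x - real j) = - central_bin (x - real j) * (w i *
        (2 * (x - real i) / (x - real i + (x - real j)) + 1 / (2 * (x - real j) - 1)))"
      by (simp add: w_def)
  qed
  have "w 1 \<noteq> 0 \<and> (\<Sum>i\<in>{1..Suc t}. w i * (2 * (x - real i) / (x - real i + x) + 1 / (2 * x - 1))) =
    w 1 * (2 * (x - 1) * (2 * x - 1 - real t) * (fact t)\<^sup>2 /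
      ((\<Prod>i\<in>{1..Suc t}. 2 * x - 1 - real i) * (\<Prod>i\<in>{1..Suc t}. 2 * x - real i)))"
  proof (rule cauchy_kernel_ratio_shifted[OF x(2) t])
    fix j assume j: "j \<in> {1..t}"
    then have "central_bin (x - real j) > 0" using x by (intro central_bin_pos) auto
    then have "- central_bin (x - real j) \<noteq> 0" by simp
    moreover have "- central_bin (x - real j) * (\<Sum>i\<in>{1..Suc t}. w i *
        (2 * (x - real i) / (x - real i + (x - real j)) + 1 / (2 * (x - real j) - 1))) = 0"
    proof -
      have "j \<le> t" using j by simp
      show ?thesis unfolding pair[OF \<open>j \<le> t\<close>, symmetric] by (rule c(2)[rule_format, OF j])
    qed
    ultimately show "(\<Sum>i\<in>{1..Suc t}. w i *
        (2 * (x - real i) / (x - real i + (x - real j)) + 1 / (2 * (x - real j) - 1))) = 0"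
      using mult_eq_0_iff by blast
  next
    obtain i where i: "i \<in> {1..Suc t}" "c i \<noteq> 0" using c(1) by auto
    then have "central_bin (x - real i) > 0" using x by (intro central_bin_pos) auto
    then show "\<exists>i\<in>{1..Suc t}. w i \<noteq> 0" using i unfolding w_def by (intro bexI[of _ i]) auto
  qed
  moreover define \<rho> where "\<rho> = 2 * (x - 1) * (2 * x - 1 - real t) * (fact t)\<^sup>2 /
      ((\<Prod>i\<in>{1..Suc t}. 2 * x - 1 - real i) * (\<Prod>i\<in>{1..Suc t}. 2 * x - real i))"
  ultimately have w: "w 1 \<noteq> 0" "(\<Sum>i\<in>{1..Suc t}. w i * (2 * (x - real i) / (x - real i + x) + 1 / (2 * x - 1))) = w 1 * \<rho>"
    by blast+
  have \<rho>: "\<rho> \<ge> 0" unfolding \<rho>_def using x t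
    by (intro divide_nonneg_nonneg mult_nonneg_nonneg prod_nonneg) auto
  have pos: "central_bin x > 0" "central_bin (x - 1) > 0" using x by (auto intro: central_bin_pos)
  define D where "D = central_bin x * central_bin (x - 1) * \<rho>"
  have D: "D \<ge> 0" unfolding D_def using pos \<rho> by simp
  have "(\<Sum>i\<in>{1..Suc t}. c i * diff_pair n (x - real i) x) = - central_bin x * (w 1 * \<rho>)"
    using pair[of 0] w(2) by (simp only: of_nat_0 diff_zero le0)
  also have "\<dots> = - (c 1 * D)" by (simp add: w_def D_def)
  finally have "\<bar>\<Sum>i\<in>{1..Suc t}. c i * diff_pair n (x - real i) x\<bar> = \<bar>c 1\<bar> * D"
    by (simp only: abs_minus_cancel abs_mult abs_of_nonneg[OF D])
  then have "\<bar>c 1\<bar> * \<bar>pbin_pf n (Suc (Suc t)) x\<bar> = \<bar>c 1\<bar> * (D * \<bar>pbin_pf n t (x - 2)\<bar>)"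
    using c(3) by (simp only: mult.assoc)
  moreover have "\<bar>c 1\<bar> \<noteq> 0" using w(1) by (auto simp: w_def)
  ultimately show ?thesis unfolding \<rho>_def[symmetric] D_def[symmetric] by (metis mult_left_cancel)
qed

text \<open>Here the factor of \<open>c i\<close> is \<open>(y + 1/2) * pbin y (1/2)\<close> at \<open>y = x - i\<close>, which equals
  \<open>y * central_bin (y - 1/2)\<close>.\<close>

lemma pbin_pf_recurrence_half_integer:
  assumes n: "2 * n = real K" and x: "x = n - real s" "x \<ge> real t + 3/2"
    and half: "1/2 \<in> unit_steps n"
  shows "\<bar>pbin_pf n (Suc (Suc t)) x\<bar> = 2 * central_bin (x - 1/2) * (x - 1) * central_bin (x - 3/2) *
    ((fact t)\<^sup>2 / ((\<Prod>i\<in>{1..t}. 2 * x - 1 - real i) * (\<Prod>i\<in>{1..Suc t}. 2 * x - real i))) * \<bar>pbin_pf n t (x - 2)\<bar>"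
proof -
  have x': "x \<ge> real t + 1" using x by simp
  obtain c where c: "\<exists>i\<in>{1..Suc t}. c i \<noteq> 0"
    "\<forall>j\<in>{1..t}. (\<Sum>i\<in>{1..Suc t}. c i * diff_pair n (x - real i) (x - real j)) = 0"
    "\<bar>c 1\<bar> * \<bar>pbin_pf n (Suc (Suc t)) x\<bar> =
      \<bar>\<Sum>i\<in>{1..Suc t}. c i * diff_pair n (x - real i) x\<bar> * \<bar>pbin_pf n t (x - 2)\<bar>"
    using pbin_pf_two_step[OF n x(1) x'] by blast
  define d where "d y = y * central_bin (y - 1/2)" for y
  have d: "(y + 1/2) * pbin y (1/2) = d y" if "y \<ge> 1/2" for y
  proof -
    have "Gamma (y + 1) = y * Gamma y" using that by (intro Gamma_plus1) (auto elim!: nonpos_Ints_cases)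
    moreover have e: "y - 1/2 + 1/2 = y" "y - 1/2 + 1 = y + 1/2" by simp_all
    moreover have "y > - 1/2" using that by simp
    ultimately show ?thesis
      unfolding d_def central_bin_def e by (simp only: pbin_centre(2) times_divide_eq_right)
  qed
  have d_pos: "d y > 0" if "y \<ge> 1/2" for y
    using that unfolding d_def by (intro mult_pos_pos central_bin_pos) auto
  define w where "w i = c i * d (x - real i)" for i
  have pair: "(\<Sum>i\<in>{1..Suc t}. c i * diff_pair n (x - real i) (x - real j)) =
    - (2 * d (x - real j) / (x - real j)) * (\<Sum>i\<in>{1..Suc t}. w i / (x - real i + (x - real j)))" if "j \<le> t" for j
    unfolding sum_distrib_left
  proof (intro sum.cong refl)
    fix i assume "i \<in> {1..Suc t}"
    then have i: "x - real i \<ge> 1/2" using x by auto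
    have "diff_pair n (x - real i) (x - real j) = - 2 * ((x - real i + 1/2) * pbin (x - real i) (1/2)) *
        ((x - real j + 1/2) * pbin (x - real j) (1/2)) / ((x - real j) * (x - real i + (x - real j)))"
      using i that x by (intro sgn_pair_pbin_half_integer[OF n _ _ _ _ half, of _ "s + i" _ "s + j"]) auto
    also have "\<dots> = - 2 * d (x - real i) * d (x - real j) / ((x - real j) * (x - real i + (x - real j)))"
      using i that x by (subst (1 2) d) auto
    finally show "c i * diff_pair n (x - real i) (x - real j) = - (2 * d (x - real j) / (x - real j)) *
        (w i / (x - real i + (x - real j)))"
      by (simp add: w_def)
  qed
  have "w 1 \<noteq> 0 \<and> (\<Sum>i\<in>{1..Suc t}. w i / (x - real i + x)) =
    w 1 * ((fact t)\<^sup>2 / ((\<Prod>i\<in>{1..t}. 2 * x - 1 - real i) * (\<Prod>i\<in>{1..Suc t}. 2 * x - real i)))"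
  proof (rule cauchy_kernel_ratio)
    show "x > real t + 1/2" using x by simp
  next
    fix j assume j: "j \<in> {1..t}"
    then have "2 * d (x - real j) / (x - real j) > 0" using x by (intro divide_pos_pos mult_pos_pos d_pos) auto
    then have "- (2 * d (x - real j) / (x - real j)) \<noteq> 0" by linarith
    moreover have "- (2 * d (x - real j) / (x - real j)) * (\<Sum>i\<in>{1..Suc t}. w i / (x - real i + (x - real j))) = 0"
    proof -
      have "j \<le> t" using j by simp
      show ?thesis unfolding pair[OF \<open>j \<le> t\<close>, symmetric] by (rule c(2)[rule_format, OF j])
    qed
    ultimately show "(\<Sum>i\<in>{1..Suc t}. w i / (x - real i + (x - real j))) = 0"
      using mult_eq_0_iff by blast
  next
    obtain i where i: "i \<in> {1..Suc t}" "c i \<noteq> 0" using c(1) by auto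
    then have "d (x - real i) > 0" using x by (intro d_pos) auto
    then show "\<exists>i\<in>{1..Suc t}. w i \<noteq> 0" using i unfolding w_def by (intro bexI[of _ i]) auto
  qed
  moreover define \<rho> where "\<rho> = (fact t)\<^sup>2 / ((\<Prod>i\<in>{1..t}. 2 * x - 1 - real i) * (\<Prod>i\<in>{1..Suc t}. 2 * x - real i))"
  ultimately have w: "w 1 \<noteq> 0" "(\<Sum>i\<in>{1..Suc t}. w i / (x - real i + x)) = w 1 * \<rho>"
    by blast+
  have \<rho>: "\<rho> \<ge> 0" unfolding \<rho>_def using x
    by (intro divide_nonneg_nonneg mult_nonneg_nonneg prod_nonneg) auto
  have pos: "2 * central_bin (x - 1/2) * (x - 1) * central_bin (x - 3/2) \<ge> 0"
    using x by (intro mult_nonneg_nonneg less_imp_le[OF central_bin_pos]) auto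
  define D where "D = 2 * central_bin (x - 1/2) * (x - 1) * central_bin (x - 3/2) * \<rho>"
  have D: "D \<ge> 0" unfolding D_def using pos \<rho> by simp
  have "(\<Sum>i\<in>{1..Suc t}. c i * diff_pair n (x - real i) x) = - (2 * d x / x) * (w 1 * \<rho>)"
    using pair[of 0] w(2) by (simp only: of_nat_0 diff_zero le0)
  also have "\<dots> = - (c 1 * D)"
    using x by (simp add: w_def d_def D_def)
  finally have "\<bar>\<Sum>i\<in>{1..Suc t}. c i * diff_pair n (x - real i) x\<bar> = \<bar>c 1\<bar> * D"
    by (simp only: abs_minus_cancel abs_mult abs_of_nonneg[OF D])
  then have "\<bar>c 1\<bar> * \<bar>pbin_pf n (Suc (Suc t)) x\<bar> = \<bar>c 1\<bar> * (D * \<bar>pbin_pf n t (x - 2)\<bar>)"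
    using c(3) by (simp only: mult.assoc)
  moreover have "\<bar>c 1\<bar> \<noteq> 0" using w(1) by (auto simp: w_def)
  ultimately show ?thesis unfolding \<rho>_def[symmetric] D_def[symmetric] by (metis mult_left_cancel)
qed

section \<open>The closed form\<close>

text \<open>The value \<open>(2 * j + 1) * central_bin j\<close>, in the form in which it occurs in the closed formula.\<close>

definition central_ratio :: "real \<Rightarrow> real" where
  "central_ratio j = Gamma (j + 3/2) / (Gamma (3/2) * Gamma (j + 1))"

definition pf_factor :: "real \<Rightarrow> real \<Rightarrow> nat \<Rightarrow> real" where
  "pf_factor x m i = fact i * Gamma (2 * x - 2 * real i + 1) / Gamma (2 * x - real i + 1) * central_ratio (m - real i)"

text \<open>The right-hand side of the theorem divided by \<open>r!\<close> and by the constants \<open>Gamma (2 * n + 1) / bmass (n - i)\<close>,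
  with \<open>x\<close> for \<open>n\<close> and \<open>m\<close> for its floor. The product starts at \<open>i = 0\<close> so that the formula is valid for \<open>r = 0\<close>,
  the starting point of the induction on even \<open>r\<close>.\<close>

definition pf_closed :: "nat \<Rightarrow> real \<Rightarrow> real \<Rightarrow> real" where
  "pf_closed r x m = 1 / fact r * (Gamma (1 + real r / 2) * Gamma (m - real r / 2 + 3/2) / Gamma (m + 3/2))
     * (\<Prod>i<r. pf_factor x m i)"

lemma Gamma_plus1_pos: "(z :: real) > 0 \<Longrightarrow> Gamma (z + 1) = z * Gamma z"
  by (intro Gamma_plus1) (auto elim!: nonpos_Ints_cases)

lemma Gamma_nonzero: "(z :: real) > 0 \<Longrightarrow> Gamma z \<noteq> 0"
  by (metis Gamma_real_pos less_irrefl)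

lemma Gamma_three_halves: "Gamma (3/2 :: real) = sqrt pi / 2"
  using Gamma_plus1_pos[of "1/2"] by (simp add: Gamma_one_half_real)

lemma central_ratio_eq:
  assumes "j > - 1/2"
  shows "central_ratio j = 2 * (j + 1/2) * central_bin j"
proof -
  have "Gamma (j + 1/2 + 1) = (j + 1/2) * Gamma (j + 1/2)" using assms by (intro Gamma_plus1_pos) simp
  moreover have "j + 1/2 + 1 = j + 3/2" by simp
  ultimately have "Gamma (j + 3/2) = (j + 1/2) * Gamma (j + 1/2)" by (simp only:)
  then show ?thesis unfolding central_ratio_def central_bin_def Gamma_three_halves by simp
qed

lemma prod_consecutive_pairs: "(\<Prod>i<t. (real i + 2) * (real i + 1)) = fact t * fact (Suc t)"
  by (induction t) (simp_all add: algebra_simps)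

lemma pf_factor_shift:
  assumes "2 * x - real i - 3 > 0"
  shows "pf_factor x m (Suc (Suc i)) =
    pf_factor (x - 2) (m - 2) i * ((real i + 2) * (real i + 1)) / ((2 * x - 2 - real i) * (2 * x - 3 - real i))"
proof -
  let ?z = "2 * x - real i - 3"
  have "Gamma (?z + 1 + 1) = (?z + 1) * (?z * Gamma ?z)"
    using assms by (subst Gamma_plus1_pos, simp, subst Gamma_plus1_pos) simp_all
  moreover have "?z + 1 + 1 = 2 * x - real (Suc (Suc i)) + 1" "2 * (x - 2) - real i + 1 = ?z"
    "2 * x - 2 * real (Suc (Suc i)) + 1 = 2 * (x - 2) - 2 * real i + 1"
    "m - real (Suc (Suc i)) = m - 2 - real i" "?z + 1 = 2 * x - 2 - real i" "?z = 2 * x - 3 - real i"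
    by simp_all
  ultimately have G: "Gamma (2 * x - real (Suc (Suc i)) + 1) =
       (2 * x - 2 - real i) * ((2 * x - 3 - real i) * Gamma (2 * (x - 2) - real i + 1))"
    and e: "2 * x - 2 * real (Suc (Suc i)) + 1 = 2 * (x - 2) - 2 * real i + 1" "m - real (Suc (Suc i)) = m - 2 - real i"
    by (simp_all only:)
  have F: "fact (Suc (Suc i)) = (real i + 2) * (real i + 1) * fact i" by (simp add: algebra_simps)
  show ?thesis
    unfolding pf_factor_def G e F
    by (simp only: times_divide_eq_left times_divide_eq_right divide_divide_eq_left mult_ac)
qed

text \<open>The factors of \<open>pf_closed (t + 2) x m\<close> with index \<open>i + 2\<close> are those of \<open>pf_closed t (x - 2) (m - 2)\<close>
  with index \<open>i\<close>, up to rational factors. One recurrence covers both parities of \<open>2 * x\<close>.\<close>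

lemma pf_closed_rec:
  assumes x: "x \<ge> real t + 1" and m: "m \<ge> real t + 1"
  shows "pf_closed (Suc (Suc t)) x m = (fact t)\<^sup>2 * (2 * m - real t - 1) * central_bin m * central_bin (m - 1) /
    ((2 * x - 1) * ((\<Prod>i<t. 2 * x - 2 - real i) * (\<Prod>i<t. 2 * x - 3 - real i))) * pf_closed t (x - 2) (m - 2)"
proof -
  define A where "A = (\<Prod>i<t. 2 * x - 2 - real i)"
  define B where "B = (\<Prod>i<t. 2 * x - 3 - real i)"
  define P where "P = (\<Prod>i<t. pf_factor (x - 2) (m - 2) i)"
  have "(\<Prod>i<t. pf_factor x m (Suc (Suc i))) =
    (\<Prod>i<t. pf_factor (x - 2) (m - 2) i * ((real i + 2) * (real i + 1)) / ((2 * x - 2 - real i) * (2 * x - 3 - real i)))"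
    using x by (intro prod.cong refl pf_factor_shift) auto
  also have "\<dots> = P * (fact t * fact (Suc t)) / (A * B)"
    unfolding prod_dividef prod.distrib[of "pf_factor (x - 2) (m - 2)"] prod_consecutive_pairs
    by (simp add: prod.distrib A_def B_def P_def)
  finally have tail: "(\<Prod>i<t. pf_factor x m (Suc (Suc i))) = P * (fact t * fact (Suc t)) / (A * B)" .
  have f0: "pf_factor x m 0 = 2 * (m + 1/2) * central_bin m"
  proof -
    have "Gamma (2 * x + 1) > 0" using x by (intro Gamma_real_pos) simp
    then show ?thesis using m by (simp add: pf_factor_def central_ratio_eq)
  qed
  have f1: "pf_factor x m 1 = 2 * (m - 1/2) * central_bin (m - 1) / (2 * x - 1)"
  proof -
    have "Gamma (2 * x - 1 + 1) = (2 * x - 1) * Gamma (2 * x - 1)"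
      using x by (intro Gamma_plus1_pos) simp
    moreover have "Gamma (2 * x - 1) > 0" using x by (intro Gamma_real_pos) simp
    moreover have "central_ratio (m - 1) = 2 * (m - 1/2) * central_bin (m - 1)"
      using central_ratio_eq[of "m - 1"] m by simp
    moreover have "2 * x - 2 * real 1 + 1 = 2 * x - 1" "2 * x - real 1 + 1 = 2 * x - 1 + 1" by simp_all
    ultimately show ?thesis unfolding pf_factor_def by (simp only:) simp
  qed
  have prod: "(\<Prod>i<Suc (Suc t). pf_factor x m i) =
      2 * (m + 1/2) * central_bin m * (2 * (m - 1/2) * central_bin (m - 1) / (2 * x - 1)) * (P * (fact t * fact (Suc t)) / (A * B))"
    unfolding prod.lessThan_Suc_shift tail f0 f1[unfolded One_nat_def] by (simp only: mult.assoc)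
  define G1 where "G1 = Gamma (1 + real t / 2)"
  define G2 where "G2 = Gamma (m - real t / 2 - 1/2)"
  define G3 where "G3 = Gamma (m - 1/2)"
  have g1: "Gamma (1 + real (Suc (Suc t)) / 2) = (1 + real t / 2) * G1"
  proof -
    have "1 + real (Suc (Suc t)) / 2 = (1 + real t / 2) + 1" by (simp add: field_simps)
    then show ?thesis unfolding G1_def by (simp only:) (rule Gamma_plus1_pos, simp)
  qed
  have g2: "Gamma (m - real (Suc (Suc t)) / 2 + 3/2) = (m - real t / 2 - 1/2) * G2"
  proof -
    have "m - real (Suc (Suc t)) / 2 + 3/2 = (m - real t / 2 - 1/2) + 1" by (simp add: field_simps)
    then show ?thesis unfolding G2_def using m by (simp only:) (rule Gamma_plus1_pos, simp)
  qed
  have g3: "Gamma (m + 3/2) = (m + 1/2) * ((m - 1/2) * G3)"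
  proof -
    have "Gamma (m - 1/2 + 1 + 1) = (m - 1/2 + 1) * ((m - 1/2) * Gamma (m - 1/2))"
      using m by (subst Gamma_plus1_pos, simp, subst Gamma_plus1_pos) simp_all
    moreover have "m - 1/2 + 1 + 1 = m + 3/2" "m - 1/2 + 1 = m + 1/2" by simp_all
    ultimately show ?thesis unfolding G3_def by (simp only:)
  qed
  have g': "m - 2 - real t / 2 + 3/2 = m - real t / 2 - 1/2" "m - 2 + 3/2 = m - 1/2" by simp_all
  have L: "pf_closed (Suc (Suc t)) x m = 1 / fact (Suc (Suc t)) *
    ((1 + real t / 2) * G1 * ((m - real t / 2 - 1/2) * G2) / ((m + 1/2) * ((m - 1/2) * G3))) *
    (2 * (m + 1/2) * central_bin m * (2 * (m - 1/2) * central_bin (m - 1) / (2 * x - 1)) * (P * (fact t * fact (Suc t)) / (A * B)))"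
    unfolding pf_closed_def g1 g2 g3 prod ..
  have R: "pf_closed t (x - 2) (m - 2) = 1 / fact t * (G1 * G2 / G3) * P"
    unfolding pf_closed_def g' G1_def G2_def G3_def P_def ..
  have coeff: "1 / fact (Suc (Suc t)) * ((1 + real t / 2) * (m - real t / 2 - 1/2)) * 4 * (fact t * fact (Suc t))
     = (fact t)\<^sup>2 * (2 * m - real t - 1) * (1 / fact t)"
  proof -
    have "4 * ((1 + real t / 2) * (m - real t / 2 - 1/2)) = (real t + 2) * (2 * m - real t - 1)"
      by (simp add: field_simps)
    moreover have "(fact (Suc (Suc t)) :: real) = (real t + 2) * fact (Suc t)" by simp
    moreover have "real t + 2 \<noteq> 0" by simp
    moreover have "1 / (a * f) * h * 4 * (g * f) = g\<^sup>2 * b * (1 / g)" if "4 * h = a * b" "a \<noteq> 0" "f \<noteq> 0" "g \<noteq> 0"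
      for a b f g h :: real
    proof -
      have "1 / (a * f) * h * 4 * (g * f) = (4 * h) * g / a" using that(3) by (simp add: mult_ac)
      also have "\<dots> = b * g" unfolding that(1) using that(2) by simp
      finally show ?thesis using that(4) by (simp add: power2_eq_square)
    qed
    ultimately show ?thesis by (metis fact_nonzero)
  qed
  have cancel: "c * (u * g1 * (v * g2) / (p * (q * g3))) * (2 * p * cm * (2 * q * cn / h) * (P * f / ab)) =
      c * (u * v) * 4 * f * (g1 * g2 / g3) * P * (cm * cn) / (h * ab)"
    if "p \<noteq> 0" "q \<noteq> 0" for c u v g1 g2 g3 p q cm cn h P f ab :: real
    using that by (simp add: mult_ac)
  have "m + 1/2 \<noteq> 0" "m - 1/2 \<noteq> 0" using m by auto
  then have "pf_closed (Suc (Suc t)) x m =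
     (1 / fact (Suc (Suc t)) * ((1 + real t / 2) * (m - real t / 2 - 1/2)) * 4 * (fact t * fact (Suc t))) *
     (G1 * G2 / G3) * P * (central_bin m * central_bin (m - 1)) / ((2 * x - 1) * (A * B))"
    unfolding L by (rule cancel)
  then show ?thesis
    unfolding coeff R A_def[symmetric] B_def[symmetric] by (simp add: mult_ac del: fact_Suc)
qed

lemma pf_closed_0: "m > - 3/2 \<Longrightarrow> pf_closed 0 x m = 1"
  using Gamma_nonzero[of "m + 3/2"] by (simp add: pf_closed_def)

lemma pf_closed_1:
  assumes "m \<ge> 0" "x \<ge> 0"
  shows "pf_closed 1 x m = 1"
proof -
  have "Gamma (m + 3/2) \<noteq> 0" "Gamma (m + 1) \<noteq> 0" "Gamma (3/2 :: real) \<noteq> 0" "Gamma (2 * x + 1) \<noteq> 0"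
    using assms by (intro Gamma_nonzero; simp)+
  moreover have "1 + real 1 / 2 = 3/2" "m - real 1 / 2 + 3/2 = m + 1" by simp_all
  ultimately show ?thesis
    unfolding pf_closed_def by (simp only:) (simp add: pf_factor_def central_ratio_def)
qed

lemma prod_first_factor: "(\<Prod>i\<in>{1..Suc t}. a - real i) = (a - 1) * (\<Prod>i<t. a - 2 - real i)"
proof -
  have "(\<Prod>i\<in>{1..Suc t}. a - real i) = (\<Prod>i<Suc t. a - real (Suc i))"
    unfolding One_nat_def by (rule prod.atLeast1_atMost_eq)
  also have "\<dots> = (a - real (Suc 0)) * (\<Prod>i<t. a - real (Suc (Suc i)))"
    by (rule prod.lessThan_Suc_shift)
  also have "\<dots> = (a - 1) * (\<Prod>i<t. a - 2 - real i)"
    by (intro arg_cong2[where f = "(*)"] prod.cong) simp_all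
  finally show ?thesis .
qed

text \<open>The case \<open>r = 2\<close> is separate because for \<open>x = 1\<close> the only parameter left in the reduction is \<open>0\<close>,
  whose residue vanishes.\<close>

lemma pbin_pf_eq_integer:
  assumes n: "2 * n = real K" and 0: "0 \<in> unit_steps n"
  shows "x = n - real s \<or> r = 0 \<Longrightarrow> x \<ge> real r - 1 \<Longrightarrow> \<bar>pbin_pf n r x\<bar> = pf_closed r x x"
proof (induction r arbitrary: x s rule: less_induct)
  case (less r)
  consider "r = 0" | "r = 1" | "r = 2" | t where "r = Suc (Suc t)" "t \<ge> 1"
    by (metis One_nat_def Suc_1 le_SucE le_zero_eq nat_le_linear not_less_eq_eq old.nat.exhaust)
  then show ?case
  proof cases
    case 1
    then show ?thesis using less.prems by (simp add: pbin_pf_def pf_closed_0)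
  next
    case 2
    then have "x = n - real s" "real s \<le> n" "x \<ge> 0" using less.prems by auto
    then show ?thesis using 2 pf_closed_1[of x x] pbin_total[OF n, of s]
      by (simp add: pbin_pf_def lessThan_Suc)
  next
    case 3
    then have x: "x = n - real s" "x \<ge> real 0 + 1" using less.prems by auto
    obtain c where c: "\<exists>i\<in>{1..Suc 0}. c i \<noteq> 0"
      "\<bar>c 1\<bar> * \<bar>pbin_pf n (Suc (Suc 0)) x\<bar> =
        \<bar>\<Sum>i\<in>{1..Suc 0}. c i * diff_pair n (x - real i) x\<bar> * \<bar>pbin_pf n 0 (x - 2)\<bar>"
      using pbin_pf_two_step[OF n x] by blast
    have "diff_pair n (x - 1) x = - (pbin (x - 1) 0 * pbin x 0) * (2 * (x - 1) / (x - 1 + x) + 1 / (2 * x - 1))"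
      using x by (intro sgn_pair_pbin_integer[OF n _ _ _ _ 0, of _ "s + 1" _ s]) auto
    also have "2 * (x - 1) / (x - 1 + x) + 1 / (2 * x - 1) = 1"
      using x by (simp add: field_simps)
    also have "pbin (x - 1) 0 = central_bin (x - 1)"
      using x by (intro pbin_centre) simp
    also have "pbin x 0 = central_bin x"
      using x by (intro pbin_centre) simp
    finally have d: "diff_pair n (x - 1) x = - (central_bin (x - 1) * central_bin x)" by simp
    have pos: "central_bin (x - 1) > 0" "central_bin x > 0" using x by (auto intro: central_bin_pos)
    have "c 1 \<noteq> 0" using c(1) by simp
    moreover have "\<bar>c 1\<bar> * \<bar>pbin_pf n 2 x\<bar> = \<bar>c 1\<bar> * (central_bin x * central_bin (x - 1))"
      using c(2) pos by (simp add: d abs_mult pbin_pf_def numeral_2_eq_2 mult.commute)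
    ultimately have "\<bar>pbin_pf n 2 x\<bar> = central_bin x * central_bin (x - 1)" by simp
    moreover have "pf_closed 2 x x = central_bin x * central_bin (x - 1)"
      using pf_closed_rec[of 0 x x] pf_closed_0[of "x - 2" "x - 2"] x by (simp add: numeral_2_eq_2)
    ultimately show ?thesis using 3 by simp
  next
    case (4 t)
    then have x: "x = n - real s" "x \<ge> real t + 1" using less.prems by auto
    have IH: "\<bar>pbin_pf n t (x - 2)\<bar> = pf_closed t (x - 2) (x - 2)"
      using less.IH[of t "x - 2" "s + 2"] 4 x by simp
    have "2 * x - 2 \<noteq> 0" "2 * x - 1 \<noteq> 0" using x 4 by auto
    moreover have "2 * (x - 1) * u * f / (((2 * x - 1 - 1) * B) * ((2 * x - 1) * A)) =
        f * u / ((2 * x - 1) * (A * B))" if "2 * x - 2 \<noteq> 0" for u f A B :: real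
    proof -
      have "2 * (x - 1) * u * f / (((2 * x - 1 - 1) * B) * ((2 * x - 1) * A)) =
         ((2 * x - 2) * (u * f)) / ((2 * x - 2) * (B * ((2 * x - 1) * A)))" by (simp add: algebra_simps)
      also have "\<dots> = (u * f) / (B * ((2 * x - 1) * A))"
        using that by (rule mult_divide_mult_cancel_left)
      finally show ?thesis by (simp only: mult_ac)
    qed
    ultimately have ratio: "2 * (x - 1) * (2 * x - 1 - real t) * (fact t)\<^sup>2 /
      ((\<Prod>i\<in>{1..Suc t}. 2 * x - 1 - real i) * (\<Prod>i\<in>{1..Suc t}. 2 * x - real i)) =
      (fact t)\<^sup>2 * (2 * x - 1 - real t) / ((2 * x - 1) * ((\<Prod>i<t. 2 * x - 2 - real i) * (\<Prod>i<t. 2 * x - 1 - 2 - real i)))"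
      unfolding prod_first_factor by blast
    have "2 * x - 1 - real t = 2 * x - real t - 1" "\<And>i. 2 * x - 1 - 2 - real i = 2 * x - 3 - real i" by simp_all
    note ratio = ratio[unfolded this]
    show ?thesis
      unfolding 4(1) pbin_pf_recurrence_integer[OF n x 4(2) 0] pf_closed_rec[OF x(2) x(2)] IH
      unfolding \<open>2 * x - 1 - real t = 2 * x - real t - 1\<close> ratio by simp
  qed
qed

lemma pbin_pf_eq_half_integer:
  assumes n: "2 * n = real K" and half: "1/2 \<in> unit_steps n"
  shows "x = n - real s \<or> r = 0 \<Longrightarrow> x \<ge> real r - 1/2 \<Longrightarrow> \<bar>pbin_pf n r x\<bar> = pf_closed r x (x - 1/2)"
proof (induction r arbitrary: x s rule: less_induct)
  case (less r)
  consider "r = 0" | "r = 1" | t where "r = Suc (Suc t)"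
    by (metis One_nat_def old.nat.exhaust)
  then show ?case
  proof cases
    case 1
    then show ?thesis using less.prems by (simp add: pbin_pf_def pf_closed_0)
  next
    case 2
    then have "x = n - real s" "real s \<le> n" "x \<ge> 1/2" using less.prems by auto
    then show ?thesis using 2 pf_closed_1[of "x - 1/2" x] pbin_total[OF n, of s]
      by (simp add: pbin_pf_def lessThan_Suc)
  next
    case (3 t)
    then have x: "x = n - real s" "x \<ge> real t + 3/2" using less.prems by auto
    then have x': "x \<ge> real t + 1" "x - 1/2 \<ge> real t + 1" by auto
    have IH: "\<bar>pbin_pf n t (x - 2)\<bar> = pf_closed t (x - 2) (x - 1/2 - 2)"
    proof -
      have "t < r" "x - 2 = n - real (s + 2)" "x - 2 \<ge> real t - 1/2" using 3 x by simp_all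
      then have "\<bar>pbin_pf n t (x - 2)\<bar> = pf_closed t (x - 2) (x - 2 - 1/2)"
        using less.IH by blast
      moreover have "x - 2 - 1/2 = x - 1/2 - 2" by simp
      ultimately show ?thesis by (simp only:)
    qed
    have "(x - 1) * (\<Prod>i<t. 2 * x - 3 - real i) * 2 =
      (\<Prod>i\<in>{1..t}. 2 * x - 1 - real i) * (2 * x - 2 - real t)"
    proof -
      have "(\<Prod>i\<in>{1..Suc t}. 2 * x - 1 - real i) = (2 * x - 1 - 1) * (\<Prod>i<t. 2 * x - 1 - 2 - real i)"
        by (rule prod_first_factor)
      moreover have "(\<Prod>i\<in>{1..Suc t}. 2 * x - 1 - real i) = (\<Prod>i\<in>{1..t}. 2 * x - 1 - real i) * (2 * x - 1 - real (Suc t))"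
        by simp
      moreover have "2 * x - 1 - real (Suc t) = 2 * x - 2 - real t" "\<And>i. 2 * x - 1 - 2 - real i = 2 * x - 3 - real i"
        "2 * x - 1 - 1 = (x - 1) * 2" by simp_all
      ultimately show ?thesis by (simp only: mult_ac)
    qed
    moreover have "(\<Prod>i\<in>{1..t}. 2 * x - 1 - real i) > 0" "(\<Prod>i<t. 2 * x - 3 - real i) > 0"
      using x by (auto intro!: prod_pos)
    moreover have "2 * (x - 1) / (C * D) = E / (D * B)"
      if "(x - 1) * B * 2 = C * E" "C > 0" "B > 0" for B C D E :: real
    proof -
      have "2 * (x - 1) / C = E / B" using that by (simp add: field_simps)
      then show ?thesis by (metis divide_divide_eq_left mult.commute)
    qed
    ultimately have key: "2 * (x - 1) / ((\<Prod>i\<in>{1..t}. 2 * x - 1 - real i) * D) = (2 * x - 2 - real t) / (D * (\<Prod>i<t. 2 * x - 3 - real i))" for D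
      by blast
    have "2 * central_bin (x - 1/2) * (x - 1) * central_bin (x - 3/2) *
       ((fact t)\<^sup>2 / ((\<Prod>i\<in>{1..t}. 2 * x - 1 - real i) * (\<Prod>i\<in>{1..Suc t}. 2 * x - real i))) =
       (fact t)\<^sup>2 * central_bin (x - 1/2) * central_bin (x - 3/2) *
       (2 * (x - 1) / ((\<Prod>i\<in>{1..t}. 2 * x - 1 - real i) * ((2 * x - 1) * (\<Prod>i<t. 2 * x - 2 - real i))))"
      unfolding prod_first_factor by (simp only: times_divide_eq_right mult_ac)
    also have "\<dots> = (fact t)\<^sup>2 * (2 * (x - 1/2) - real t - 1) * central_bin (x - 1/2) * central_bin (x - 1/2 - 1) /
    ((2 * x - 1) * ((\<Prod>i<t. 2 * x - 2 - real i) * (\<Prod>i<t. 2 * x - 3 - real i)))"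
    proof -
      have "2 * (x - 1/2) - real t - 1 = 2 * x - 2 - real t" "x - 1/2 - 1 = x - 3/2" by simp_all
      then show ?thesis unfolding key by (simp only: times_divide_eq_right mult_ac)
    qed
    finally show ?thesis
      unfolding 3 pbin_pf_recurrence_half_integer[OF n x half] pf_closed_rec[OF x'] IH by (simp only:)
  qed
qed

section \<open>From the weighted sum to the signed sum\<close>

lemma rbin_falling: "rbin (n - real j) k = (\<Prod>l<j. (n - real l)\<^sup>2 - k\<^sup>2) * rbin n k"
proof (induction j)
  case (Suc j)
  have "n - real (Suc j) = (n - real j) - 1" by simp
  then show ?case by (simp only: rbin_pred Suc prod.lessThan_Suc mult_ac)
qed simp

lemma sgn_vand_lessThan: "sgn_vand {..<r} x = (\<Prod>j<r. \<Prod>i<j. sgn (x i - x j))"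
  unfolding sgn_vand_def
proof (rule prod.cong[OF refl])
  fix j assume "j \<in> {..<r}"
  then have "{..<j} = {i \<in> {..<r}. i < j}" by auto
  then show "(\<Prod>i<r. if i < j then sgn (x i - x j) else 1) = (\<Prod>i<j. sgn (x i - x j))"
    by (simp only: prod.inter_filter[OF finite_lessThan])
qed

text \<open>Comparing squares is comparing absolute values, so the absolute value of the product of differences is
  the product itself times a sign product with key \<open>abs\<close>.\<close>

lemma abs_diff_squares: "\<bar>a\<^sup>2 - b\<^sup>2\<bar> = - 1 * sgn (\<bar>a\<bar> - \<bar>b\<bar>) * (b\<^sup>2 - a\<^sup>2)" for a b :: real
proof -
  have e: "a\<^sup>2 - b\<^sup>2 = (\<bar>a\<bar> - \<bar>b\<bar>) * (\<bar>a\<bar> + \<bar>b\<bar>)"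
    by (simp add: algebra_simps power2_eq_square)
  then have "\<bar>a\<^sup>2 - b\<^sup>2\<bar> = \<bar>\<bar>a\<bar> - \<bar>b\<bar>\<bar> * (\<bar>a\<bar> + \<bar>b\<bar>)" by (simp add: abs_mult)
  also have "\<dots> = sgn (\<bar>a\<bar> - \<bar>b\<bar>) * (a\<^sup>2 - b\<^sup>2)" unfolding e by (simp add: abs_sgn)
  finally show ?thesis by (simp add: algebra_simps)
qed

text \<open>The Leibniz expansion is taken in the basis of polynomials \<open>\<Prod>l<j. (k\<^sup>2 - (n - l)\<^sup>2)\<close>, since
  multiplication by them turns the weight with parameter \<open>n\<close> into a multiple of the one with parameter \<open>n - j\<close>. By
  antisymmetry all permutations contribute equally. The overall sign is not tracked: the left-hand
  side is nonnegative, so absolute values can be taken at the end.\<close>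

lemma weighted_sum_eq_pbin_pf:
  assumes n: "2 * n = real K" and r: "n \<ge> real r - 1"
  shows "(\<Sum>x\<in>{..<r} \<rightarrow>\<^sub>E unit_steps n. (\<Prod>j<r. \<Prod>i<j. \<bar>(x i)\<^sup>2 - (x j)\<^sup>2\<bar>) *
      (\<Prod>i<r. Gamma (2 * n + 1) * rbin n (x i))) =
    fact r * (\<Prod>i<r. Gamma (2 * n + 1) / bmass (n - real i)) * \<bar>pbin_pf n r n\<bar>"
proof -
  let ?X = "unit_steps n" and ?A = "{..<r}"
  let ?S = "\<Sum>x\<in>?A \<rightarrow>\<^sub>E ?X. (\<Prod>j<r. \<Prod>i<j. \<bar>(x i)\<^sup>2 - (x j)\<^sup>2\<bar>) * (\<Prod>i<r. Gamma (2 * n + 1) * rbin n (x i))"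
  define q where "q j = (\<Prod>l<j. [:- ((n - real l)\<^sup>2), 1:])" for j
  have q: "degree (q j) = j" "Polynomial.coeff (q j) j = 1" for j
  proof -
    show d: "degree (q j) = j" by (simp add: q_def degree_prod_eq_sum_degree)
    have "lead_coeff (q j) = 1" unfolding q_def lead_coeff_prod by simp
    then show "Polynomial.coeff (q j) j = 1" by (simp add: d)
  qed
  define c where "c j = (- 1) ^ j * (Gamma (2 * n + 1) / bmass (n - real j))" for j
  have wq: "Gamma (2 * n + 1) * rbin n k * poly (q j) (k\<^sup>2) = c j * pbin (n - real j) k" if "j < r" for j k
  proof -
    have "poly (q j) (k\<^sup>2) = (\<Prod>l<j. (- 1) * ((n - real l)\<^sup>2 - k\<^sup>2))"
      by (simp add: q_def poly_prod)
    also have "\<dots> = (- 1) ^ j * (\<Prod>l<j. (n - real l)\<^sup>2 - k\<^sup>2)"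
      unfolding prod.distrib by simp
    finally have "rbin n k * poly (q j) (k\<^sup>2) = (- 1) ^ j * rbin (n - real j) k"
      unfolding rbin_falling by simp
    moreover have "bmass (n - real j) \<noteq> 0" using that r by (intro less_imp_neq[THEN not_sym] bmass_pos) linarith
    ultimately show ?thesis unfolding c_def pbin_def by (simp add: mult.assoc)
  qed
  define \<sigma> where "\<sigma> = (\<Prod>j<r. \<Prod>i<j. - 1 :: real)"
  have \<sigma>: "\<bar>\<sigma>\<bar> = 1" by (simp add: \<sigma>_def abs_prod)
  have vand: "(\<Prod>j<r. \<Prod>i<j. \<bar>(x i)\<^sup>2 - (x j)\<^sup>2\<bar>) = \<sigma> * sgn_vand ?A (\<lambda>i. \<bar>x i\<bar>) *
      (\<Sum>p | p permutes ?A. of_int (sign p) * (\<Prod>i<r. poly (q (p i)) ((x i)\<^sup>2)))" for x :: "nat \<Rightarrow> real"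
    unfolding prod_differences_leibniz[OF q, symmetric] sgn_vand_lessThan abs_diff_squares prod.distrib \<sigma>_def ..
  have summand: "(\<Prod>j<r. \<Prod>i<j. \<bar>(x i)\<^sup>2 - (x j)\<^sup>2\<bar>) * (\<Prod>i<r. Gamma (2 * n + 1) * rbin n (x i)) =
      \<sigma> * (\<Sum>p | p permutes ?A. of_int (sign p) * (\<Prod>i<r. c (p i)) *
        (sgn_vand ?A (\<lambda>i. \<bar>x i\<bar>) * (\<Prod>i<r. pbin (n - real (p i)) (x i))))" for x
  proof -
    have "(\<Prod>i<r. poly (q (p i)) ((x i)\<^sup>2)) * (\<Prod>i<r. Gamma (2 * n + 1) * rbin n (x i)) =
       (\<Prod>i<r. c (p i)) * (\<Prod>i<r. pbin (n - real (p i)) (x i))" if p: "p permutes ?A" for p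
      unfolding prod.distrib[symmetric]
    proof (intro prod.cong refl)
      fix i assume "i \<in> ?A"
      then have "p i < r" using permutes_in_image[OF p, of i] by simp
      from wq[OF this, of "x i"]
      show "poly (q (p i)) ((x i)\<^sup>2) * (Gamma (2 * n + 1) * rbin n (x i)) = c (p i) * pbin (n - real (p i)) (x i)"
        by (simp only: mult_ac)
    qed
    then have "of_int (sign p) * (\<Prod>i<r. poly (q (p i)) ((x i)\<^sup>2)) * (\<Prod>i<r. Gamma (2 * n + 1) * rbin n (x i)) =
       of_int (sign p) * ((\<Prod>i<r. c (p i)) * (\<Prod>i<r. pbin (n - real (p i)) (x i)))" if "p permutes ?A" for p
      using that by (simp only: mult.assoc)
    then have "(\<Sum>p | p permutes ?A. of_int (sign p) * (\<Prod>i<r. poly (q (p i)) ((x i)\<^sup>2))) * (\<Prod>i<r. Gamma (2 * n + 1) * rbin n (x i))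
      = (\<Sum>p | p permutes ?A. of_int (sign p) * ((\<Prod>i<r. c (p i)) * (\<Prod>i<r. pbin (n - real (p i)) (x i))))"
      unfolding sum_distrib_right by (intro sum.cong refl) simp
    then show ?thesis
      unfolding vand mult.assoc by (simp only: sum_distrib_left mult_ac)
  qed
  have "?S = \<sigma> * (\<Sum>p | p permutes ?A. of_int (sign p) * (\<Prod>i<r. c (p i)) *
      sgn_sum ?X abs ?A (\<lambda>i. pbin (n - real (p i))))"
    unfolding summand sum_distrib_left[symmetric] sgn_sum_def
    by (subst sum.swap) (simp only: sum_distrib_left)
  also have "(\<Sum>p | p permutes ?A. of_int (sign p) * (\<Prod>i<r. c (p i)) *
      sgn_sum ?X abs ?A (\<lambda>i. pbin (n - real (p i)))) =
     (\<Sum>p | p permutes ?A. (\<Prod>i<r. c i) * pbin_pf n r n)"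
  proof (intro sum.cong refl)
    fix p assume "p \<in> {p. p permutes ?A}"
    then have p: "p permutes ?A" by simp
    have "(\<Prod>i<r. c (p i)) = (\<Prod>i<r. c i)"
      using prod.permute[OF p, of c] by (simp add: o_def)
    moreover have "sgn_sum ?X abs ?A (\<lambda>i. pbin (n - real (p i))) = of_int (sign p) * pbin_pf n r n"
      using sgn_sum_permute[OF p, of ?X abs "\<lambda>i. pbin (n - real i)"] by (simp add: pbin_pf_def)
    moreover have "(of_int (sign p) :: real) * of_int (sign p) = 1"
      by (simp add: sign_def)
    ultimately show "of_int (sign p) * (\<Prod>i<r. c (p i)) * sgn_sum ?X abs ?A (\<lambda>i. pbin (n - real (p i)))
       = (\<Prod>i<r. c i) * pbin_pf n r n"
      by (simp add: mult_ac)
  qed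
  also have "\<dots> = fact r * ((\<Prod>i<r. c i) * pbin_pf n r n)"
    by (simp add: card_permutations)
  finally have S: "?S = \<sigma> * (fact r * ((\<Prod>i<r. c i) * pbin_pf n r n))" .
  have nonneg: "Gamma (2 * n + 1) / bmass (n - real i) \<ge> 0" if "i < r" for i
    using that r n by (intro divide_nonneg_nonneg less_imp_le[OF bmass_pos] less_imp_le[OF Gamma_real_pos]) auto
  have weight_nonneg: "Gamma (2 * n + 1) * rbin n k \<ge> 0" if k: "k \<in> ?X" for k
  proof -
    obtain j where "j \<le> K" "k = real j - n" using k unfolding unit_steps_eq[OF n] by auto
    then show ?thesis by (simp add: pbin_eq_binomial[OF n])
  qed
  have "?S \<ge> 0"
  proof (rule sum_nonneg, rule mult_nonneg_nonneg)
    fix x assume "x \<in> ?A \<rightarrow>\<^sub>E ?X"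
    then show "(\<Prod>i<r. Gamma (2 * n + 1) * rbin n (x i)) \<ge> 0"
      by (intro prod_nonneg ballI weight_nonneg) auto
  qed (intro prod_nonneg, simp)
  then have "?S = \<bar>?S\<bar>" by simp
  also have "\<dots> = fact r * ((\<Prod>i<r. \<bar>c i\<bar>) * \<bar>pbin_pf n r n\<bar>)"
    unfolding S by (simp add: abs_mult \<sigma> abs_prod)
  also have "(\<Prod>i<r. \<bar>c i\<bar>) = (\<Prod>i<r. Gamma (2 * n + 1) / bmass (n - real i))"
  proof (intro prod.cong refl)
    fix i assume "i \<in> ?A"
    then have "Gamma (2 * n + 1) / bmass (n - real i) \<ge> 0" by (intro nonneg) simp
    moreover have "\<bar>(- 1) ^ i * A\<bar> = A" if "A \<ge> 0" for A :: real
      using that by (simp add: abs_mult power_abs)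
    ultimately show "\<bar>c i\<bar> = Gamma (2 * n + 1) / bmass (n - real i)"
      unfolding c_def by blast
  qed
  finally show ?thesis by (simp only: mult.assoc)
qed

lemma bmass_powr:
  assumes "2 * n = real K" "real i \<le> n"
  shows "Gamma (2 * n - 2 * real i + 1) / bmass (n - real i) = 2 powr (2 * n - 2 * real i)"
proof -
  define L where "L = K - 2 * i"
  have L: "2 * n - 2 * real i = real L" using assms by (simp add: L_def of_nat_diff)
  then have "n - real i = real L / 2" by simp
  then have "bmass (n - real i) = fact L / 2 ^ L" by (simp only: bmass_half_nat)
  moreover have "Gamma (real L + 1) = fact L" using Gamma_fact[of L] by (simp add: add.commute)
  ultimately show ?thesis unfolding L by (simp add: powr_realpow)
qed

lemma normalised_pf_closed:
  assumes n: "2 * n = real K" and r: "n \<ge> real r - 1" "r > 0" and m: "m > - 1"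
  shows "fact r * (\<Prod>i<r. Gamma (2 * n + 1) / bmass (n - real i)) * pf_closed r n m =
     2 powr (2 * real r * n - real r * (real r - 1)) *
         (Gamma (1 + real r / 2) / Gamma (3 / 2)) *
         (Gamma (m - real r / 2 + 3 / 2) / Gamma (m + 1)) *
         (\<Prod>i = 1..r - 1.
            (Gamma (real i + 1) / Gamma (3 / 2)) *
            ((Gamma (2 * n + 1) * Gamma (m - real i + 3 / 2)) /
             (Gamma (2 * n - real i + 1) * Gamma (m - real i + 1))))"
proof -
  define h where "h i = (Gamma (real i + 1) / Gamma (3 / 2)) *
            ((Gamma (2 * n + 1) * Gamma (m - real i + 3 / 2)) /
             (Gamma (2 * n - real i + 1) * Gamma (m - real i + 1)))" for i
  have "Gamma (2 * n + 1) / bmass (n - real i) * pf_factor n m i = 2 powr (2 * n - 2 * real i) * h i"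
    if "i < r" for i
  proof -
    have "real i \<le> n" using that r by linarith
    note b = bmass_powr[OF n this, symmetric]
    have "Gamma (real i + 1) = fact i" using Gamma_fact[of i] by (simp add: add.commute)
    then show ?thesis unfolding b h_def pf_factor_def central_ratio_def
      by (simp only: times_divide_eq_left times_divide_eq_right divide_divide_eq_left mult_ac)
  qed
  then have "(\<Prod>i<r. Gamma (2 * n + 1) / bmass (n - real i)) * (\<Prod>i<r. pf_factor n m i) =
     (\<Prod>i<r. 2 powr (2 * n - 2 * real i)) * (\<Prod>i<r. h i)"
    unfolding prod.distrib[symmetric] by (intro prod.cong) auto
  also have "(\<Prod>i<r. 2 powr (2 * n - 2 * real i)) = 2 powr (2 * real r * n - real r * (real r - 1))"
    by (induction r) (simp_all add: powr_add[symmetric] algebra_simps)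
  also have "(\<Prod>i<r. h i) = h 0 * (\<Prod>i = 1..r - 1. h i)"
  proof -
    have "{..<r} = insert 0 {1..r - 1}" using r(2) by auto
    then show ?thesis by simp
  qed
  also have "h 0 = Gamma (m + 3/2) / (Gamma (3/2) * Gamma (m + 1))"
    using Gamma_nonzero[of "2 * n + 1"] n by (simp add: h_def)
  finally have prods: "(\<Prod>i<r. Gamma (2 * n + 1) / bmass (n - real i)) * (\<Prod>i<r. pf_factor n m i) =
    2 powr (2 * real r * n - real r * (real r - 1)) *
    (Gamma (m + 3/2) / (Gamma (3/2) * Gamma (m + 1)) * (\<Prod>i = 1..r - 1. h i))" .
  have "F * A * (1 / F * (g1 * g2 / g3) * B) = P * (g1 / g) * (g2 / g4) * H"
    if "A * B = P * (g3 / (g * g4) * H)" "F \<noteq> 0" "g3 \<noteq> 0" for A B F P H g g1 g2 g3 g4 :: real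
  proof -
    have "F * A * (1 / F * (g1 * g2 / g3) * B) = (A * B) * (g1 * g2 / g3)" using that(2) by simp
    also have "\<dots> = P * (g1 / g) * (g2 / g4) * H" unfolding that(1) using that(3) by simp
    finally show ?thesis .
  qed
  note regroup = this
  have "Gamma (m + 3/2) \<noteq> 0" using m by (intro Gamma_nonzero) simp
  then show ?thesis
    unfolding pf_closed_def h_def[symmetric] by (intro regroup[OF prods]) simp_all
qed

theorem proposition5p3:
  fixes r :: nat and n :: real
  assumes "r > 0"
    and "n \<in> \<int> \<or> n \<in> half_integers"
    and "n \<ge> real r - 1"
  shows "(\<Sum>k \<in> {1..r} \<rightarrow>\<^sub>E unit_steps n.
            (\<Prod>(i, j) \<in> {(i, j). 1 \<le> i \<and> i < j \<and> j \<le> r}. \<bar>(k i)\<^sup>2 - (k j)\<^sup>2\<bar>) *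
            (\<Prod>i = 1..r. binom (2 * n) (n + k i)))
       = 2 powr (2 * real r * n - real r * (real r - 1)) *
         (Gamma (1 + real r / 2) / Gamma (3 / 2)) *
         (Gamma (real_of_int \<lfloor>n\<rfloor> - real r / 2 + 3 / 2) / Gamma (real_of_int \<lfloor>n\<rfloor> + 1)) *
         (\<Prod>i = 1..r - 1.
            (Gamma (real i + 1) / Gamma (3 / 2)) *
            ((Gamma (2 * n + 1) * Gamma (real_of_int \<lfloor>n\<rfloor> - real i + 3 / 2)) /
             (Gamma (2 * n - real i + 1) * Gamma (real_of_int \<lfloor>n\<rfloor> - real i + 1))))"
proof -
  let ?X = "unit_steps n" and ?m = "real_of_int \<lfloor>n\<rfloor>"
  have n0: "n \<ge> 0" using assms by linarith
  have "2 * n \<in> \<int>"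
    using assms(2)
  proof
    assume "n \<in> half_integers"
    then have "2 * (n - 1/2) + 1 \<in> \<int>" unfolding half_integers_def by (intro Ints_add Ints_mult) auto
    then show ?thesis by simp
  qed (intro Ints_mult, auto)
  then obtain z where "2 * n = of_int z" by (auto elim: Ints_cases)
  then have "2 * n = real (nat z)" using n0 by simp
  then obtain K where n: "2 * n = real K" by blast
  have closed: "\<bar>pbin_pf n r n\<bar> = pf_closed r n ?m"
    using assms(2)
  proof
    assume "n \<in> \<int>"
    then have "0 \<in> ?X" and m: "?m = n" using n0 by (auto simp: unit_steps_def elim: Ints_cases)
    then show ?thesis unfolding m using pbin_pf_eq_integer[OF n, of n 0 r] assms(3) by simp
  next
    assume "n \<in> half_integers"
    then obtain a where a: "n - 1/2 = of_int a" by (auto simp: half_integers_def elim: Ints_cases)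
    then have "a \<ge> 0" "int r - 1 \<le> a" using n0 assms(3) by linarith+
    then have "n \<ge> 1/2" and r: "n \<ge> real r - 1/2" using a by linarith+
    moreover have "1/2 + n \<in> \<int>"
    proof -
      have "1/2 + n = of_int (a + 1)" using a by simp
      then show ?thesis by (simp only: Ints_of_int)
    qed
    ultimately have "1/2 \<in> ?X" by (simp add: unit_steps_def)
    moreover have m: "?m = n - 1/2"
    proof -
      have "\<lfloor>n\<rfloor> = a" using a by linarith
      then show ?thesis using a by simp
    qed
    moreover note r
    ultimately show ?thesis unfolding m using pbin_pf_eq_half_integer[OF n, of n 0 r] by simp
  qed
  have weight: "binom (2 * n) (n + k) = Gamma (2 * n + 1) * rbin n k" if k: "k \<in> ?X" for k
  proof -
    obtain j where j: "j \<le> K" "k = real j - n" using k unfolding unit_steps_eq[OF n] by auto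
    then have "n + k = real j" by simp
    then have "binom (2 * n) (n + k) = real (K choose j)"
      unfolding binom_def n by simp
    then show ?thesis unfolding j(2) pbin_eq_binomial[OF n j(1)] by simp
  qed
  have set: "{1..r} = Suc ` {..<r}" by (simp add: image_Suc_lessThan)
  have pairs: "(\<Prod>(i, j) \<in> {(i, j). 1 \<le> i \<and> i < j \<and> j \<le> r}. f i j) = (\<Prod>j<r. \<Prod>i<j. f (Suc i) (Suc j))"
    for f :: "nat \<Rightarrow> nat \<Rightarrow> real"
  proof -
    have "(\<Prod>j<r. \<Prod>i<j. f (Suc i) (Suc j)) = (\<Prod>(j, i)\<in>(SIGMA j:{..<r}. {..<j}). f (Suc i) (Suc j))"
      by (rule prod.Sigma) auto
    also have "\<dots> = (\<Prod>(i, j) \<in> {(i, j). 1 \<le> i \<and> i < j \<and> j \<le> r}. f i j)"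
      by (rule prod.reindex_bij_witness[of _ "\<lambda>(i, j). (j - 1, i - 1)" "\<lambda>(j, i). (Suc i, Suc j)"]) auto
    finally show ?thesis ..
  qed
  have "(\<Sum>k \<in> {1..r} \<rightarrow>\<^sub>E ?X.
            (\<Prod>(i, j) \<in> {(i, j). 1 \<le> i \<and> i < j \<and> j \<le> r}. \<bar>(k i)\<^sup>2 - (k j)\<^sup>2\<bar>) *
            (\<Prod>i = 1..r. binom (2 * n) (n + k i)))
    = (\<Sum>k \<in> Suc ` {..<r} \<rightarrow>\<^sub>E ?X. (\<Prod>j<r. \<Prod>i<j. \<bar>(k (Suc i))\<^sup>2 - (k (Suc j))\<^sup>2\<bar>) *
            (\<Prod>i<r. Gamma (2 * n + 1) * rbin n (k (Suc i))))"
    unfolding pairs set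
  proof (intro sum.cong refl arg_cong2[where f = "(*)"])
    fix k assume k: "k \<in> Suc ` {..<r} \<rightarrow>\<^sub>E ?X"
    have "(\<Prod>i\<in>Suc ` {..<r}. binom (2 * n) (n + k i)) = (\<Prod>i<r. binom (2 * n) (n + k (Suc i)))"
      by (subst prod.reindex) auto
    also have "\<dots> = (\<Prod>i<r. Gamma (2 * n + 1) * rbin n (k (Suc i)))"
      using k by (intro prod.cong refl weight) auto
    finally show "(\<Prod>i\<in>Suc ` {..<r}. binom (2 * n) (n + k i)) = (\<Prod>i<r. Gamma (2 * n + 1) * rbin n (k (Suc i)))" .
  qed
  also have "\<dots> = (\<Sum>x\<in>{..<r} \<rightarrow>\<^sub>E ?X. (\<Prod>j<r. \<Prod>i<j. \<bar>(x i)\<^sup>2 - (x j)\<^sup>2\<bar>) *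
      (\<Prod>i<r. Gamma (2 * n + 1) * rbin n (x i)))"
  proof -
    have bij: "bij_betw (\<lambda>x. restrict (\<lambda>i. x (Suc i)) {..<r}) (Suc ` {..<r} \<rightarrow>\<^sub>E ?X) ({..<r} \<rightarrow>\<^sub>E ?X)"
      by (rule bij_betw_PiE_reindex) simp
    show ?thesis
      unfolding sum.reindex_bij_betw[OF bij, symmetric]
      by (intro sum.cong refl arg_cong2[where f = "(*)"] prod.cong) auto
  qed
  also have "\<dots> = fact r * (\<Prod>i<r. Gamma (2 * n + 1) / bmass (n - real i)) * pf_closed r n ?m"
    unfolding weighted_sum_eq_pbin_pf[OF n assms(3)] closed ..
  also have "?m > - 1" using n0 by linarith
  note normalised_pf_closed[OF n assms(3,1) this]
  finally show ?thesis .
qed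

end
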